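(* For $q\in\mathbb{C}$ with $|q|<1$, the following four identities hold: $$\sum_{i,j\ge0}\frac{q^{\frac{3}{2}i^2-ij+\frac{3}{2}j^2-\frac{1}{2}i+\frac{1}{2}j}}{(q;q)_{2i}(q;q)_{2j}}=\frac{(-q^3,-q^5,q^8;q^8)_\infty}{(q;q)_\infty (q^2,q^8;q^{10})_\infty},$$ $$\sum_{i,j\ge0}\frac{q^{\frac{3}{2}i^2-ij+\frac{3}{2}j^2+\frac{1}{2}i+\frac{3}{2}j}}{(q;q)_{2i+1}(q;q)_{2j+1}}=\frac{(-q,-q^7,q^8;q^8)_\infty}{(q;q)_\infty (q^2,q^8;q^{10})_\infty},$$ $$\sum_{i,j\ge0}\frac{q^{\frac{3}{2}i^2-ij+\frac{3}{2}j^2+\frac{3}{2}i+\frac{1}{2}j}}{(q;q)_{2i+1}(q;q)_{2j}}=\frac{(-q^3,-q^5,q^8;q^8)_\infty}{(q;q)_\infty (q^4,q^6;q^{10})_\infty},$$ $$\sum_{i,j\ge0}\frac{q^{\frac{3}{2}i^2-ij+\frac{3}{2}j^2-\frac{1}{2}i+\frac{5}{2}j}}{(q;q)_{2i}(q;q)_{2j+1}}=\frac{(-q,-q^7,q^8;q^8)_\infty}{(q;q)_\infty (q^4,q^6;q^{10})_\infty}.$$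
   Context: For $|q|<1$: $(a;q)_\infty=\prod_{k\ge0}(1-aq^k)$; for integers $n\ge0$, $(a;q)_n=\prod_{k=0}^{n-1}(1-aq^k)$; and $(a_1,\dots,a_m;q)_n=\prod_{k=1}^m(a_k;q)_n$ (also for $n=\infty$). All exponents of $q$ appearing are integers. *)

theory Defs
  imports "HOL-Analysis.Analysis"
begin

definition qpoch :: "complex \<Rightarrow> complex \<Rightarrow> nat \<Rightarrow> complex" where
  "qpoch a q n = (\<Prod>k<n. 1 - a * q ^ k)"

definition qpoch_inf :: "complex \<Rightarrow> complex \<Rightarrow> complex" where
  "qpoch_inf a q = (\<Prod>k. 1 - a * q ^ k)"

definition qpochs_inf :: "complex list \<Rightarrow> complex \<Rightarrow> complex" where
  "qpochs_inf as q = (\<Prod>a\<leftarrow>as. qpoch_inf a q)"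

lemma has_prod_qpoch_inf:
  assumes "norm q < 1"
  shows "(\<lambda>k. 1 - a * q ^ k) has_prod qpoch_inf a q"
proof -
  have "summable (\<lambda>k. norm ((1 - a * q ^ k) - 1))"
    using assms by (auto simp: norm_mult norm_power intro!: summable_mult summable_geometric)
  hence "abs_convergent_prod (\<lambda>k. 1 - a * q ^ k)"
    by (rule summable_imp_abs_convergent_prod)
  hence "convergent_prod (\<lambda>k. 1 - a * q ^ k)"
    by (rule abs_convergent_prod_imp_convergent_prod)
  thus ?thesis
    unfolding qpoch_inf_def by (rule convergent_prod_has_prod)
qed

text \<open>
  Twice the exponents of \<open>q\<close> in the four double sums. They are even and nonnegative,
  so halving them with \<open>div\<close> is exact and \<open>powi\<close> never inverts \<open>q\<close>, which may be zero.
\<close>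

lemma qexponents_even:
  fixes i j :: int
  shows "even (3 * i^2 - 2 * i * j + 3 * j^2 - i + j)"
    and "even (3 * i^2 - 2 * i * j + 3 * j^2 + i + 3 * j)"
    and "even (3 * i^2 - 2 * i * j + 3 * j^2 + 3 * i + j)"
    and "even (3 * i^2 - 2 * i * j + 3 * j^2 - i + 5 * j)"
  by auto

lemma qexponents_nonneg:
  fixes i j :: nat
  shows "3 * int i^2 - 2 * int i * int j + 3 * int j^2 - int i + int j \<ge> 0"
    and "3 * int i^2 - 2 * int i * int j + 3 * int j^2 + int i + 3 * int j \<ge> 0"
    and "3 * int i^2 - 2 * int i * int j + 3 * int j^2 + 3 * int i + int j \<ge> 0"
    and "3 * int i^2 - 2 * int i * int j + 3 * int j^2 - int i + 5 * int j \<ge> 0"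
proof -
  have sq: "(int i - int j)^2 = int i^2 - 2 * int i * int j + int j^2"
    by (simp add: power2_eq_square algebra_simps)
  have "int i \<le> int i^2"
    by (cases i) (auto simp: power2_eq_square algebra_simps)
  moreover have "(int i - int j)^2 \<ge> 0" "int i^2 \<ge> 0" "int j^2 \<ge> 0" "int i \<ge> 0" "int j \<ge> 0"
    by simp_all
  ultimately show "3 * int i^2 - 2 * int i * int j + 3 * int j^2 - int i + int j \<ge> 0"
    "3 * int i^2 - 2 * int i * int j + 3 * int j^2 + int i + 3 * int j \<ge> 0"
    "3 * int i^2 - 2 * int i * int j + 3 * int j^2 + 3 * int i + int j \<ge> 0"
    "3 * int i^2 - 2 * int i * int j + 3 * int j^2 - int i + 5 * int j \<ge> 0"
    unfolding sq by linarith+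
qed

end

theory Submission
  imports Defs
begin

text \<open>
  Put \<open>q = Q\<^sup>2\<close> and \<open>tri(k) = k(k-1)/2\<close>. With \<open>N\<close> and \<open>r\<close> essentially the sum and the difference of the summation
  indices and \<open>a \<in> {0,1}\<close>, the summands become, up to a factor \<open>Q\<close>,
  \<open>Q\<^bsup>N(N+2a) + tri(2r+a)\<^esup> / ((q;q)\<^bsub>N-r\<^esub> (q;q)\<^bsub>N+r+a\<^esub>)\<close> with a prescribed parity of \<open>N-r\<close>. This parity of
  \<open>N-r\<close> is also the parity of the power of \<open>Q\<close>, so the two identities belonging to the same \<open>a\<close> are the even and odd
  parts in \<open>Q\<close> of a single identity without parity restriction. In that identity the sum over \<open>r\<close> is
  \<open>1/(Q;Q)\<^bsub>2N+a\<^esub>\<close>, and Euler's expansion of \<open>(Q;Q\<^sup>2)\<^sub>\<infinity>/(Q;Q\<^sup>2)\<^bsub>N+a\<^esub>\<close> reduces the remaining sum over \<open>N\<close> to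
  a Rogers--Ramanujan sum in \<open>Q\<^sup>4\<close> divided by \<open>(Q;Q\<^sup>2)\<^sub>\<infinity>\<close>. The latter factor is a theta series over \<open>(q;q)\<^sub>\<infinity>\<close>, whose
  even and odd parts are triple products in \<open>q\<^sup>8\<close>. The Rogers--Ramanujan identities themselves follow from two
  steps of the Bailey chain.
\<close>

subsection \<open>Dominated convergence for unordered sums\<close>

text \<open>Lebesgue's theorem for the counting measure: on absolutely summable families
  \<open>infsum\<close> agrees with \<open>infsetsum\<close>, which is an integral. The passages to
  the limit inside a sum below all rest on it.\<close>

lemma infsum_dominated_convergence:
  fixes f :: "nat \<Rightarrow> 'a \<Rightarrow> 'b :: {banach, second_countable_topology}"
  assumes g: "g summable_on A"
    and bound: "\<And>n x. x \<in> A \<Longrightarrow> norm (f n x) \<le> g x"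
    and lim: "\<And>x. x \<in> A \<Longrightarrow> (\<lambda>n. f n x) \<longlonglongrightarrow> h x"
  shows "(\<lambda>n. infsum (f n) A) \<longlonglongrightarrow> infsum h A" "h summable_on A"
proof -
  have boundh: "norm (h x) \<le> g x" if "x \<in> A" for x
    by (rule tendsto_upperbound[OF tendsto_norm[OF lim[OF that]]]) (use bound that in auto)
  have sf: "(\<lambda>x. norm (f n x)) summable_on A" for n
    by (rule Infinite_Sum.abs_summable_on_comparison_test'[OF g]) (use bound in auto)
  have sh: "(\<lambda>x. norm (h x)) summable_on A"
    by (rule Infinite_Sum.abs_summable_on_comparison_test'[OF g]) (use boundh in auto)
  show "h summable_on A"
    using sh by (rule abs_summable_summable)
  have "(\<lambda>x. norm (g x)) summable_on A"
    using g by (rule summable_on_iff_abs_summable_on_real[THEN iffD1])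
  then have "integrable (count_space A) g"
    unfolding abs_summable_equivalent Infinite_Set_Sum.abs_summable_on_def .
  then have "(\<lambda>n. infsetsum (f n) A) \<longlonglongrightarrow> infsetsum h A"
    unfolding infsetsum_def
  proof (rule integral_dominated_convergence[rotated 2])
    show "AE x in count_space A. (\<lambda>n. f n x) \<longlonglongrightarrow> h x"
      using lim by (simp add: AE_count_space)
    show "AE x in count_space A. norm (f n x) \<le> g x" for n
      using bound by (simp add: AE_count_space)
  qed simp_all
  then show "(\<lambda>n. infsum (f n) A) \<longlonglongrightarrow> infsum h A"
    using sf sh unfolding abs_summable_equivalent by (simp add: infsetsum_infsum)
qed

subsection \<open>The function \<open>1/(q;q)\<^sub>k\<close>, extended by zero to negative indices\<close>

lemma qpoch_0 [simp]: "qpoch a q 0 = 1"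
  by (simp add: qpoch_def)

lemma qpoch_Suc: "qpoch a q (Suc n) = qpoch a q n * (1 - a * q ^ n)"
  by (simp add: qpoch_def)

lemma qpoch_add: "qpoch a q (m + n) = qpoch a q m * qpoch (a * q ^ m) q n"
  by (induction n) (simp_all add: qpoch_Suc power_add mult.assoc)

lemma qpoch_Suc_shift: "qpoch a q (Suc n) = (1 - a) * qpoch (a * q) q n"
  using qpoch_add[of a q 1 n] by (simp add: qpoch_Suc)

text \<open>The factors are sorted by the residue of their index modulo \<open>d\<close>; the
  induction adds one block of \<open>d\<close> consecutive factors.\<close>

lemma qpoch_dissect: "qpoch a q (d * n) = (\<Prod>j<d. qpoch (a * q ^ j) (q ^ d) n)"
proof (induction n)
  case (Suc n)
  have "qpoch a q (d * Suc n) = qpoch a q (d * n) * qpoch (a * q ^ (d * n)) q d"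
    by (simp add: qpoch_add[symmetric] add.commute)
  also have "qpoch (a * q ^ (d * n)) q d = (\<Prod>j<d. 1 - a * q ^ j * (q ^ d) ^ n)"
    by (simp add: qpoch_def power_mult mult_ac)
  finally show ?case
    by (simp add: Suc.IH qpoch_Suc prod.distrib)
qed auto

lemma LIMSEQ_qpoch:
  assumes "norm q < 1"
  shows "(\<lambda>n. qpoch a q n) \<longlonglongrightarrow> qpoch_inf a q"
  unfolding qpoch_def using has_prod_imp_tendsto'[OF has_prod_qpoch_inf[OF assms]] .

lemma qpoch_inf_nonzero:
  assumes q: "norm q < 1" and "\<And>k. a * q ^ k \<noteq> 1"
  shows "qpoch_inf a q \<noteq> 0"
proof
  assume "qpoch_inf a q = 0"
  then have "(\<lambda>k. 1 - a * q ^ k) has_prod 0"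
    using has_prod_qpoch_inf[OF q, of a] by simp
  then show False
    unfolding has_prod_0_iff using assms(2) by auto
qed

lemma qpoch_inf_dissect:
  assumes q: "norm q < 1" and d: "d > 0"
  shows "qpoch_inf a q = (\<Prod>j<d. qpoch_inf (a * q ^ j) (q ^ d))"
proof (rule LIMSEQ_unique)
  have "filterlim (\<lambda>n. d * n) sequentially sequentially"
    using d by (intro filterlim_subseq) (auto simp: strict_mono_def)
  then show "(\<lambda>n. qpoch a q (d * n)) \<longlonglongrightarrow> qpoch_inf a q"
    by (rule filterlim_compose[OF LIMSEQ_qpoch[OF q]])
  have "norm (q ^ d) < 1"
    using q d by (simp add: norm_power power_less_one_iff)
  then show "(\<lambda>n. qpoch a q (d * n)) \<longlonglongrightarrow> (\<Prod>j<d. qpoch_inf (a * q ^ j) (q ^ d))"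
    unfolding qpoch_dissect by (intro tendsto_prod LIMSEQ_qpoch)
qed

lemma power_neq_1:
  fixes q :: complex
  assumes "norm q < 1" "n > 0"
  shows "q ^ n \<noteq> 1"
  using assms power_less_one_iff[of "norm q" n] by (metis norm_ge_zero norm_one norm_power order_less_irrefl)

lemma qpoch_self_nonzero:
  assumes "norm q < 1"
  shows "qpoch q q n \<noteq> 0"
  using power_neq_1[OF assms, of "Suc _"] by (auto simp: qpoch_def)

lemma qpoch_inf_self_nonzero:
  assumes "norm q < 1"
  shows "qpoch_inf q q \<noteq> 0"
  using power_neq_1[OF assms, of "Suc _"] by (intro qpoch_inf_nonzero[OF assms]) auto

text \<open>Zero at negative \<open>k\<close> is the value forced by the recurrence
  \<open>rpoch_minus_1\<close>, since \<open>1 - q powi 0 = 0\<close>. The recurrence then holds on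
  all integers, and summation ranges may be enlarged freely.\<close>

definition rpoch :: "complex \<Rightarrow> int \<Rightarrow> complex" where
  "rpoch q k = (if k < 0 then 0 else 1 / qpoch q q (nat k))"

lemma rpoch_neg [simp]: "k < 0 \<Longrightarrow> rpoch q k = 0"
  by (simp add: rpoch_def)

lemma rpoch_of_nat: "rpoch q (int n) = 1 / qpoch q q n"
  by (simp add: rpoch_def)

lemma rpoch_0 [simp]: "rpoch q 0 = 1"
  by (simp add: rpoch_def)

lemma rpoch_minus_1:
  assumes "norm q < 1"
  shows "rpoch q (k - 1) = (1 - q powi k) * rpoch q k"
proof (cases "k \<le> 0")
  case False
  then obtain n where "k = int (Suc n)"
    by (metis not_le zero_less_imp_eq_int Suc_pred)
  then show ?thesis
    using qpoch_self_nonzero[OF assms, of "Suc n"]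
    by (auto simp add: rpoch_def qpoch_Suc nat_add_distrib power_int_add power_int_def field_simps)
qed (cases "k = 0"; simp)

lemma rpoch_Suc:
  assumes "norm q < 1"
  shows "rpoch q (int n) = (1 - q ^ Suc n) * rpoch q (int (Suc n))"
proof -
  have "int (Suc n) - 1 = int n"
    by simp
  then show ?thesis
    using rpoch_minus_1[OF assms, of "int (Suc n)"] by (simp only: power_int_of_nat)
qed

text \<open>A convergent sequence is bounded, and the limit exists because (q;q)_inf is nonzero. The
  constant enters the majorants for dominated convergence.\<close>

lemma rpoch_bounded:
  assumes "norm q < 1"
  obtains C where "C > 0" "\<And>k. norm (rpoch q k) \<le> C"
proof -
  have "(\<lambda>n. 1 / qpoch q q n) \<longlonglongrightarrow> 1 / qpoch_inf q q"
    by (intro tendsto_intros LIMSEQ_qpoch assms qpoch_inf_self_nonzero)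
  then have "Bseq (\<lambda>n. 1 / qpoch q q n)"
    by (intro convergent_imp_Bseq convergentI)
  then obtain C where "C > 0" "\<And>n. norm (1 / qpoch q q n) \<le> C"
    by (auto elim!: BseqE)
  then show thesis
    by (intro that[of C]) (auto simp: rpoch_def)
qed

lemma LIMSEQ_rpoch:
  assumes "norm q < 1"
  shows "(\<lambda>n. rpoch q (int n + c)) \<longlonglongrightarrow> 1 / qpoch_inf q q"
proof -
  have "(\<lambda>n. 1 / qpoch q q n) \<longlonglongrightarrow> 1 / qpoch_inf q q"
    by (intro tendsto_intros LIMSEQ_qpoch assms qpoch_inf_self_nonzero)
  moreover have "filterlim (\<lambda>n. nat (int n + c)) sequentially sequentially"
    unfolding filterlim_at_top
  proof
    fix Z :: nat
    show "\<forall>\<^sub>F n in sequentially. Z \<le> nat (int n + c)"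
      using eventually_ge_at_top[of "Z + nat \<bar>c\<bar>"] by eventually_elim linarith
  qed
  ultimately have "(\<lambda>n. 1 / qpoch q q (nat (int n + c))) \<longlonglongrightarrow> 1 / qpoch_inf q q"
    by (rule filterlim_compose)
  moreover have "\<forall>\<^sub>F n in sequentially. 1 / qpoch q q (nat (int n + c)) = rpoch q (int n + c)"
    using eventually_ge_at_top[of "nat \<bar>c\<bar>"] by eventually_elim (auto simp: rpoch_def)
  ultimately show ?thesis
    by (rule Lim_transform_eventually)
qed

text \<open>The q-Pascal rule for arbitrary weights \<open>c\<close>: write 1 - q^(n+1) = (1 - q^k)
  + q^k (1 - q^(n+1-k)); each bracket lowers the index of one of the two \<open>rpoch\<close>
  factors, and the first sum is then shifted by one. The finite identities below are inductions
  along this rule.\<close>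

lemma rpoch_pascal:
  assumes q: "norm q < 1"
  shows "(1 - q ^ Suc n) * (\<Sum>k\<le>Suc n. c k * rpoch q (int k) * rpoch q (int (Suc n) - int k))
       = (\<Sum>k\<le>n. (c (Suc k) + q ^ k * c k) * rpoch q (int k) * rpoch q (int n - int k))"
proof -
  have "(1 - q ^ Suc n) * (c k * rpoch q (int k) * rpoch q (int (Suc n) - int k))
      = c k * rpoch q (int k - 1) * rpoch q (int (Suc n) - int k)
        + q ^ k * c k * rpoch q (int k) * rpoch q (int n - int k)" if "k \<le> Suc n" for k
  proof -
    have "q powi (int (Suc n) - int k) = q ^ (Suc n - k)"
      using that by (metis of_nat_diff power_int_of_nat)
    moreover have "q ^ Suc n = q ^ k * q ^ (Suc n - k)"
      using that by (simp flip: power_add)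
    ultimately have "c k * ((1 - q powi int k) * rpoch q (int k)) * rpoch q (int (Suc n) - int k)
      + q ^ k * c k * rpoch q (int k) * ((1 - q powi (int (Suc n) - int k)) * rpoch q (int (Suc n) - int k))
      = (1 - q ^ Suc n) * (c k * rpoch q (int k) * rpoch q (int (Suc n) - int k))"
      by (simp add: algebra_simps)
    then show ?thesis
      unfolding rpoch_minus_1[OF q, symmetric] by simp
  qed
  then have "(1 - q ^ Suc n) * (\<Sum>k\<le>Suc n. c k * rpoch q (int k) * rpoch q (int (Suc n) - int k))
     = (\<Sum>k\<le>Suc n. c k * rpoch q (int k - 1) * rpoch q (int (Suc n) - int k))
     + (\<Sum>k\<le>Suc n. q ^ k * c k * rpoch q (int k) * rpoch q (int n - int k))"
    unfolding sum_distrib_left sum.distrib[symmetric] by (intro sum.cong) auto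
  also have "(\<Sum>k\<le>Suc n. c k * rpoch q (int k - 1) * rpoch q (int (Suc n) - int k))
     = (\<Sum>k\<le>n. c (Suc k) * rpoch q (int k) * rpoch q (int n - int k))"
    by (subst sum.atMost_Suc_shift) simp
  also have "(\<Sum>k\<le>Suc n. q ^ k * c k * rpoch q (int k) * rpoch q (int n - int k))
     = (\<Sum>k\<le>n. q ^ k * c k * rpoch q (int k) * rpoch q (int n - int k))"
    by simp
  finally show ?thesis
    by (simp only: distrib_right sum.distrib)
qed

subsection \<open>Finite identities\<close>

definition tri :: "int \<Rightarrow> int" where
  "tri k = k * (k - 1) div 2"

lemma tri_double: "2 * tri k = k * (k - 1)"
  by (simp add: tri_def)

lemma tri_0 [simp]: "tri 0 = 0"
  by (simp add: tri_def)

lemma tri_1 [simp]: "tri 1 = 0"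
  by (simp add: tri_def)

lemma tri_add: "tri (k + m) = tri k + k * m + tri m"
proof -
  have "2 * tri (k + m) = 2 * (tri k + k * m + tri m)"
    by (simp add: distrib_left tri_double) (simp add: algebra_simps)
  then show ?thesis by simp
qed

lemma tri_add_1: "tri (k + 1) = tri k + k"
  by (simp add: tri_add)

lemma tri_minus: "tri (- k) = tri k + k"
proof -
  have "2 * tri (- k) = 2 * (tri k + k)"
    by (simp add: distrib_left tri_double) (simp add: algebra_simps)
  then show ?thesis by simp
qed

lemma powi_mult_eq:
  fixes q :: "'a :: field"
  shows "q \<noteq> 0 \<Longrightarrow> a + b = c \<Longrightarrow> q powi a * q powi b = q powi c"
  using power_int_add[of q a b] by auto

text \<open>Gauss's q-binomial theorem divided by (q;q)_n. The Pascal rule turns the weights for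
  \<open>x\<close> into \<open>1 + x\<close> times the weights for \<open>x * q\<close>, so the
  induction peels off the first factor of (-x;q)_n and must keep \<open>x\<close> general.\<close>

lemma q_binomial:
  assumes q: "norm q < 1" "q \<noteq> 0"
  shows "(\<Sum>k\<le>n. x ^ k * q powi tri (int k) * rpoch q (int k) * rpoch q (int n - int k))
       = qpoch (- x) q n * rpoch q (int n)"
proof (induction n arbitrary: x)
  case (Suc n)
  define c where "c x k = x ^ k * q powi tri (int k)" for x :: complex and k
  have c: "c x (Suc k) + q ^ k * c x k = (1 + x) * c (x * q) k" for k
  proof -
    have "q powi tri (int k) * q powi int k = q powi tri (int (Suc k))"
      using q(2) tri_add_1[of "int k"] by (intro powi_mult_eq) (auto simp: add.commute)
    then show ?thesis
      unfolding c_def power_mult_distrib power_int_of_nat by (simp add: distrib_right mult_ac)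
  qed
  have "(1 - q ^ Suc n) * (\<Sum>k\<le>Suc n. c x k * rpoch q (int k) * rpoch q (int (Suc n) - int k))
      = (1 + x) * (\<Sum>k\<le>n. c (x * q) k * rpoch q (int k) * rpoch q (int n - int k))"
    unfolding rpoch_pascal[OF q(1)] c by (simp add: sum_distrib_left mult_ac)
  also have "\<dots> = (1 + x) * qpoch (- x * q) q n * rpoch q (int n)"
    using Suc.IH[of "x * q"] by (simp add: c_def mult_ac)
  also have "(1 + x) * qpoch (- x * q) q n = qpoch (- x) q (Suc n)"
    by (simp add: qpoch_Suc_shift)
  also have "rpoch q (int n) = (1 - q ^ Suc n) * rpoch q (int (Suc n))"
    by (rule rpoch_Suc[OF q(1)])
  finally have "(1 - q ^ Suc n) * (\<Sum>k\<le>Suc n. c x k * rpoch q (int k) * rpoch q (int (Suc n) - int k))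
      = (1 - q ^ Suc n) * (qpoch (- x) q (Suc n) * rpoch q (int (Suc n)))"
    by (simp only: mult_ac)
  moreover have "1 - q ^ Suc n \<noteq> 0"
    using power_neq_1[OF q(1), of "Suc n"] by simp
  ultimately show ?case
    unfolding c_def using mult_left_cancel by blast
qed simp

text \<open>The reversal \<open>k \<mapsto> n - k\<close> shows that the exponents \<open>tri x\<close> and \<open>tri (x + 1)\<close>, where
  \<open>x = 2 k - n\<close>, give the same sum.\<close>

lemma sum_tri_rpoch:
  assumes q: "norm q < 1" "q \<noteq> 0"
  shows "(\<Sum>k\<le>n. q powi tri (2 * int k - int n) * rpoch (q\<^sup>2) (int k) * rpoch (q\<^sup>2) (int n - int k))
       = 1 / qpoch q q n"
proof (induction n)
  case (Suc n)
  have q2: "norm (q\<^sup>2) < 1"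
    using q(1) by (simp add: norm_power abs_square_less_1)
  define c where "c n k = q powi tri (2 * int k - int n)" for n k
  define S where "S = (\<Sum>k\<le>n. c n k * rpoch (q\<^sup>2) (int k) * rpoch (q\<^sup>2) (int n - int k))"
  have c1: "c (Suc n) (Suc k) = q powi tri (2 * int k - int n + 1)" for k
    by (simp add: c_def algebra_simps)
  \<comment> \<open>This makes the second half of the Pascal rule in base q^2 equal to
    \<open>q ^ Suc n\<close> times \<open>S\<close>; the first half becomes \<open>S\<close> itself
    after reversal.\<close>
  have c2: "(q\<^sup>2) ^ k * c (Suc n) k = q ^ Suc n * c n k" for k
  proof -
    have "tri (2 * int k - int n) = tri (2 * int k - int n - 1) + 2 * int k - int n - 1"
      using tri_add_1[of "2 * int k - int n - 1"] by simp
    then have "2 * int k + tri (2 * int k - int (Suc n)) = int (Suc n) + tri (2 * int k - int n)"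
      by (simp add: algebra_simps)
    then have "q powi (2 * int k) * c (Suc n) k = q powi int (Suc n) * c n k"
      unfolding c_def using powi_mult_eq[OF q(2)] by metis
    then show ?thesis
      by (simp only: power_int_of_nat power_int_mult power_int_numeral)
  qed
  have "(\<Sum>k\<le>n. c (Suc n) (Suc k) * rpoch (q\<^sup>2) (int k) * rpoch (q\<^sup>2) (int n - int k)) = S"
    unfolding S_def
  proof (rule sum.reindex_bij_witness[of _ "\<lambda>k. n - k" "\<lambda>k. n - k"])
    fix k assume "k \<in> {..n}"
    moreover from this have "tri (2 * int (n - k) - int n) = tri (- (2 * int k - int n))"
      by (simp add: of_nat_diff algebra_simps)
    ultimately show "c n (n - k) * rpoch (q\<^sup>2) (int (n - k)) * rpoch (q\<^sup>2) (int n - int (n - k))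
        = c (Suc n) (Suc k) * rpoch (q\<^sup>2) (int k) * rpoch (q\<^sup>2) (int n - int k)"
      using tri_minus[of "2 * int k - int n"] unfolding c1 by (simp add: c_def tri_add_1 of_nat_diff)
  qed simp_all
  then have "(\<Sum>k\<le>n. (c (Suc n) (Suc k) + (q\<^sup>2) ^ k * c (Suc n) k) * rpoch (q\<^sup>2) (int k) * rpoch (q\<^sup>2) (int n - int k))
      = (1 + q ^ Suc n) * S"
    unfolding c2 by (simp only: distrib_right sum.distrib S_def sum_distrib_left mult.assoc mult_1_left)
  then have "(1 - (q\<^sup>2) ^ Suc n) * (\<Sum>k\<le>Suc n. c (Suc n) k * rpoch (q\<^sup>2) (int k) * rpoch (q\<^sup>2) (int (Suc n) - int k))
      = (1 + q ^ Suc n) * S"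
    unfolding rpoch_pascal[OF q2] .
  \<comment> \<open>The factor \<open>1 + q ^ Suc n\<close> cancels from both sides, which leaves
    the recursion of \<open>1 / qpoch q q n\<close>.\<close>
  moreover have *: "1 - (q\<^sup>2) ^ Suc n = (1 + q ^ Suc n) * (1 - q ^ Suc n)"
    by (simp only: power2_eq_square power_mult_distrib) (simp add: algebra_simps)
  moreover have nz: "1 - q ^ Suc n \<noteq> 0" "1 + q ^ Suc n \<noteq> 0"
    using power_neq_1[OF q(1), of "Suc n"] power_neq_1[OF q2, of "Suc n"] *
    by (simp_all only: right_minus_eq zero_less_Suc simp_thms) force+
  ultimately have "(1 - q ^ Suc n) * (\<Sum>k\<le>Suc n. c (Suc n) k * rpoch (q\<^sup>2) (int k) * rpoch (q\<^sup>2) (int (Suc n) - int k)) = S"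
    by (simp only: mult.assoc mult_cancel_left simp_thms)
  also have "S = 1 / qpoch q q n"
    using Suc.IH by (simp add: S_def c_def)
  finally have "(\<Sum>k\<le>Suc n. c (Suc n) k * rpoch (q\<^sup>2) (int k) * rpoch (q\<^sup>2) (int (Suc n) - int k))
      = 1 / qpoch q q n / (1 - q ^ Suc n)"
    by (subst nonzero_eq_divide_eq[OF nz(1)]) (simp only: mult.commute)
  then show ?case
    unfolding c_def qpoch_Suc power_Suc[symmetric] divide_divide_eq_left .
qed simp

text \<open>Gauss's alternating sum of q-binomial coefficients, divided by (q;q)_n. For the weights
  (-1)^k the Pascal rule yields -(-1)^k (1 - q^k), which lowers the index \<open>k\<close> once
  more, so the sums satisfy (1 - q^n) D(n) = D(n-2).\<close>

lemma sum_alternating_rpoch: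
  assumes q: "norm q < 1"
  shows "(\<Sum>k\<le>n. (-1) ^ k * rpoch q (int k) * rpoch q (int n - int k))
       = (if even n then rpoch (q\<^sup>2) (int (n div 2)) else 0)"
proof (induction n rule: less_induct)
  case (less n)
  define D where "D n = (\<Sum>k\<le>n. (-1) ^ k * rpoch q (int k) * rpoch q (int n - int k))" for n
  consider "n = 0" | "n = 1" | m where "n = Suc (Suc m)"
    by (metis One_nat_def not0_implies_Suc)
  then show ?case
  proof cases
    case 3
    have "(1 - q ^ n) * D n = (\<Sum>k\<le>Suc m. ((-1) ^ Suc k + q ^ k * (-1) ^ k) * rpoch q (int k) * rpoch q (int (Suc m) - int k))"
      unfolding D_def 3 by (rule rpoch_pascal[OF q])
    also have "\<dots> = (\<Sum>k\<le>Suc m. - ((-1) ^ k) * rpoch q (int k - 1) * rpoch q (int (Suc m) - int k))"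
      unfolding rpoch_minus_1[OF q] by (intro sum.cong) (auto simp: algebra_simps)
    also have "\<dots> = D m"
      unfolding D_def by (subst sum.atMost_Suc_shift) simp
    finally have "(1 - q ^ n) * D n = D m" .
    moreover have "D m = (if even m then rpoch (q\<^sup>2) (int (m div 2)) else 0)"
      unfolding D_def using less.IH[of m] 3 by auto
    moreover have "rpoch (q\<^sup>2) (int (m div 2)) = (1 - q ^ n) * rpoch (q\<^sup>2) (int (n div 2))" if "even m"
    proof -
      have "norm (q\<^sup>2) < 1"
        using q by (simp add: norm_power abs_square_less_1)
      from rpoch_minus_1[OF this, of "int (n div 2)"]
      have "rpoch (q\<^sup>2) (int (n div 2) - 1) = (1 - (q\<^sup>2) ^ (n div 2)) * rpoch (q\<^sup>2) (int (n div 2))"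
        by simp
      moreover have "(q\<^sup>2) ^ (n div 2) = q ^ n"
        using that 3 by (metis dvd_mult_div_cancel even_Suc_Suc_iff power_mult)
      moreover have "int (n div 2) - 1 = int (m div 2)"
        using 3 by simp
      ultimately show ?thesis
        by (simp only:)
    qed
    moreover have "1 - q ^ n \<noteq> 0"
      using power_neq_1[OF q, of n] 3 by simp
    ultimately show ?thesis
      using 3 unfolding D_def[symmetric] by (cases "even m") auto
  qed auto
qed

text \<open>A limiting case of the q-Chu-Vandermonde sum. The Pascal rule carries the weights for
  the offset \<open>c\<close> exactly to those for \<open>c + 1\<close>, hence the induction over
  all \<open>c\<close>.\<close>

lemma q_vandermonde:
  assumes q: "norm q < 1" "q \<noteq> 0"
  shows "(\<Sum>t\<le>n. q powi (int t * (int t + c)) * rpoch q (int t + c) * rpoch q (int t) * rpoch q (int n - int t))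
       = rpoch q (int n) * rpoch q (int n + c)"
proof (induction n arbitrary: c)
  case (Suc n)
  define f where "f c t = q powi (int t * (int t + c)) * rpoch q (int t + c)" for c t
  have f: "f c (Suc t) + q ^ t * f c t = f (c + 1) t" for t
  proof -
    have "rpoch q (int t + c) = (1 - q powi (int t + c + 1)) * rpoch q (int t + c + 1)"
      using rpoch_minus_1[OF q(1), of "int t + c + 1"] by simp
    moreover have "q ^ t * q powi (int t * (int t + c)) = q powi (int t * (int t + (c + 1)))"
      unfolding power_int_of_nat[symmetric] by (intro powi_mult_eq q(2)) (simp add: algebra_simps)
    moreover have "q powi (int t * (int t + (c + 1))) * q powi (int t + c + 1) = q powi (int (Suc t) * (int (Suc t) + c))"
      by (intro powi_mult_eq q(2)) (simp add: algebra_simps)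
    moreover have "rpoch q (int (Suc t) + c) = rpoch q (int t + c + 1)" "rpoch q (int t + (c + 1)) = rpoch q (int t + c + 1)"
      by (simp_all add: algebra_simps)
    ultimately show ?thesis
      unfolding f_def by (simp only: mult.assoc[symmetric]) (simp add: algebra_simps)
  qed
  have "(1 - q ^ Suc n) * (\<Sum>t\<le>Suc n. f c t * rpoch q (int t) * rpoch q (int (Suc n) - int t))
      = rpoch q (int n) * rpoch q (int n + (c + 1))"
    unfolding rpoch_pascal[OF q(1)] f using Suc.IH[of "c + 1"] by (simp add: f_def)
  moreover have "rpoch q (int n) = (1 - q ^ Suc n) * rpoch q (int (Suc n))"
    by (rule rpoch_Suc[OF q(1)])
  moreover have "1 - q ^ Suc n \<noteq> 0"
    using power_neq_1[OF q(1), of "Suc n"] by simp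
  moreover have "int n + (c + 1) = int (Suc n) + c"
    by simp
  ultimately have "(\<Sum>t\<le>Suc n. f c t * rpoch q (int t) * rpoch q (int (Suc n) - int t))
      = rpoch q (int (Suc n)) * rpoch q (int (Suc n) + c)"
    by (simp only: mult.assoc mult_cancel_left simp_thms)
  then show ?case
    unfolding f_def .
qed simp

subsection \<open>Bilateral sums and the Jacobi triple product\<close>

text \<open>The bilateral form of Bailey's transform: \<open>\<alpha>\<close> is one half of a
  Bailey pair relative to q^a, and the value at \<open>n\<close> is the other half. Outside the
  range of summation one of the two \<open>rpoch\<close> factors is zero.\<close>

definition bil :: "complex \<Rightarrow> nat \<Rightarrow> nat \<Rightarrow> (int \<Rightarrow> complex) \<Rightarrow> complex" where
  "bil q a n \<alpha> = (\<Sum>r\<in>{- int (n + a)..int n}. \<alpha> r * rpoch q (int n - r) * rpoch q (int n + r + int a))"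

lemma bil_conv_sum_atMost:
  "bil q a n \<alpha> = (\<Sum>k\<le>2 * n + a. \<alpha> (int k - int (n + a)) * rpoch q (int k) * rpoch q (int (2 * n + a) - int k))"
  unfolding bil_def
  by (rule sum.reindex_bij_witness[of _ "\<lambda>k. int k - int (n + a)" "\<lambda>r. nat (r + int (n + a))"])
     (auto simp: algebra_simps)

lemma has_sum_bil:
  "((\<lambda>r. \<alpha> r * rpoch q (int n - r) * rpoch q (int n + r + int a)) has_sum bil q a n \<alpha>) UNIV"
  by (rule has_sum_finite_neutralI[of "{- int (n + a)..int n}"]) (auto simp: bil_def not_le)

text \<open>Both kernel factors tend to 1/(q;q)_inf and are bounded, so dominated convergence
  applies. This turns finite identities for \<open>bil\<close> into evaluations of theta
  series.\<close>

lemma bil_LIMSEQ: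
  assumes q: "norm q < 1" and \<alpha>: "(\<lambda>r. norm (\<alpha> r)) summable_on UNIV"
  shows "(\<lambda>n. bil q a n \<alpha>) \<longlonglongrightarrow> infsum \<alpha> UNIV / (qpoch_inf q q)\<^sup>2"
proof -
  obtain C where C: "C > 0" "\<And>k. norm (rpoch q k) \<le> C"
    using rpoch_bounded[OF q] by blast
  have "(\<lambda>n. \<Sum>\<^sub>\<infinity>r. \<alpha> r * rpoch q (int n - r) * rpoch q (int n + r + int a))
     \<longlonglongrightarrow> (\<Sum>\<^sub>\<infinity>r. \<alpha> r * (1 / qpoch_inf q q) * (1 / qpoch_inf q q))"
  proof (rule infsum_dominated_convergence)
    show "(\<lambda>r. norm (\<alpha> r) * C\<^sup>2) summable_on UNIV"
      by (intro summable_on_cmult_left \<alpha>)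
    show "norm (\<alpha> r * rpoch q (int n - r) * rpoch q (int n + r + int a)) \<le> norm (\<alpha> r) * C\<^sup>2" for n r
      using C unfolding norm_mult power2_eq_square mult.assoc by (intro mult_mono mult_left_mono) auto
    have "(\<lambda>n. rpoch q (int n - r)) \<longlonglongrightarrow> 1 / qpoch_inf q q" "(\<lambda>n. rpoch q (int n + r + int a)) \<longlonglongrightarrow> 1 / qpoch_inf q q" for r
      using LIMSEQ_rpoch[OF q, of "- r"] LIMSEQ_rpoch[OF q, of "r + int a"] by (simp_all add: add.assoc)
    then show "(\<lambda>n. \<alpha> r * rpoch q (int n - r) * rpoch q (int n + r + int a))
        \<longlonglongrightarrow> \<alpha> r * (1 / qpoch_inf q q) * (1 / qpoch_inf q q)" for r
      by (intro tendsto_mult tendsto_const)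
  qed
  moreover have "(\<Sum>\<^sub>\<infinity>r. \<alpha> r * (1 / qpoch_inf q q) * (1 / qpoch_inf q q)) = infsum \<alpha> UNIV / (qpoch_inf q q)\<^sup>2"
    unfolding mult.assoc by (subst infsum_cmult_left') (simp add: power2_eq_square)
  ultimately show ?thesis
    by (simp add: infsumI[OF has_sum_bil])
qed

text \<open>Consecutive terms have ratio \<open>w * q ^ n\<close>, which tends to 0 whatever
  \<open>w\<close> is.\<close>

lemma summable_norm_theta_nat:
  fixes q w :: complex
  assumes q: "norm q < 1" "q \<noteq> 0"
  shows "summable (\<lambda>n. norm (w ^ n * q powi tri (int n)))"
proof -
  have "(\<lambda>n. norm w * norm q ^ n) \<longlonglongrightarrow> norm w * 0"
    using q by (intro tendsto_intros LIMSEQ_power_zero) auto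
  then have "\<forall>\<^sub>F n in sequentially. norm w * norm q ^ n < 1 / 2"
    by (rule order_tendstoD(2)) simp
  then obtain N where N: "\<And>n. n \<ge> N \<Longrightarrow> norm w * norm q ^ n < 1 / 2"
    by (auto simp: eventually_sequentially)
  show ?thesis
  proof (rule summable_ratio_test[of "1 / 2" N])
    fix n assume "n \<ge> N"
    have "q powi tri (int n) * q powi int n = q powi tri (int (Suc n))"
      using q(2) tri_add_1[of "int n"] by (intro powi_mult_eq) (auto simp: add.commute)
    then have "w ^ Suc n * q powi tri (int (Suc n)) = (w * q ^ n) * (w ^ n * q powi tri (int n))"
      by (simp only: power_int_of_nat power_Suc mult_ac)
    then have "norm (w ^ Suc n * q powi tri (int (Suc n))) = (norm w * norm q ^ n) * norm (w ^ n * q powi tri (int n))"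
      by (simp only: norm_mult norm_power)
    also have "\<dots> \<le> 1 / 2 * norm (w ^ n * q powi tri (int n))"
      using N[OF \<open>n \<ge> N\<close>] by (intro mult_right_mono) auto
    finally show "norm (norm (w ^ Suc n * q powi tri (int (Suc n)))) \<le> 1 / 2 * norm (norm (w ^ n * q powi tri (int n)))"
      by simp
  qed simp
qed

text \<open>The negative half of a theta series is the positive half with \<open>q / w\<close> in
  place of \<open>w\<close>.\<close>

lemma powi_tri_minus:
  fixes q w :: complex
  assumes "q \<noteq> 0" "w \<noteq> 0"
  shows "w powi (- int n) * q powi tri (- int n) = (q / w) ^ n * q powi tri (int n)"
  using assms by (simp add: tri_minus power_int_add power_int_minus power_divide field_simps)

lemma summable_norm_theta:
  fixes q w :: complex
  assumes q: "norm q < 1" "q \<noteq> 0" and w: "w \<noteq> 0"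
  shows "(\<lambda>r. norm (w powi r * q powi tri r)) summable_on UNIV"
proof -
  have nat: "(\<lambda>n. norm (w ^ n * q powi tri (int n))) summable_on UNIV" for w
    using summable_norm_theta_nat[OF q, of w] by (intro norm_summable_imp_summable_on) simp
  have "(\<lambda>r. norm (w powi r * q powi tri r)) summable_on range int"
    by (subst summable_on_reindex) (use nat[of w] in \<open>auto simp: o_def\<close>)
  moreover have "(\<lambda>r. norm (w powi r * q powi tri r)) summable_on range (\<lambda>n. - int n)"
    by (subst summable_on_reindex) (use nat[of "q / w"] in \<open>auto simp: o_def inj_def powi_tri_minus[OF q(2) w]\<close>)
  ultimately have "(\<lambda>r. norm (w powi r * q powi tri r)) summable_on (range int \<union> range (\<lambda>n. - int n))"
    by (rule summable_on_union)
  also have "range int \<union> range (\<lambda>n. - int n) = UNIV"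
    by (auto simp: image_iff) (metis int_cases2)
  finally show ?thesis .
qed

text \<open>Shifting the index by \<open>n + a\<close> makes the truncated theta series an instance
  of the q-binomial theorem with x = w q^(-(n+a)); the addition rule for \<open>tri\<close> supplies
  the prefactor.\<close>

lemma bil_theta:
  assumes q: "norm q < 1" "q \<noteq> 0" and w: "w \<noteq> 0"
  shows "bil q a n (\<lambda>r. w powi r * q powi tri r)
       = (q / w) ^ (n + a) * q powi tri (int (n + a)) * qpoch (- (w * q powi (- int (n + a)))) q (2 * n + a) * rpoch q (int (2 * n + a))"
proof -
  define m where "m = n + a"
  have "w powi (int k - int m) * q powi tri (int k - int m)
     = ((q / w) ^ m * q powi tri (int m)) * ((w * q powi (- int m)) ^ k * q powi tri (int k))" for k
  proof -
    have "(q powi (- int m)) ^ k = q powi (- int k * int m)"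
      by (simp add: power_int_power' mult.commute)
    moreover have "tri (int k - int m) = tri (int k) + (- int k * int m) + tri (- int m)"
      using tri_add[of "int k" "- int m"] by simp
    moreover have "w powi (int k - int m) = w ^ k * w powi (- int m)"
      using w power_int_add[of w "int k" "- int m"] by simp
    ultimately show ?thesis
      unfolding powi_tri_minus[OF q(2) w, symmetric] power_mult_distrib
      using q(2) by (simp only: power_int_add simp_thms mult_ac)
  qed
  then show ?thesis
    unfolding bil_conv_sum_atMost m_def[symmetric]
    by (simp only: mult.assoc sum_distrib_left[symmetric] q_binomial[OF q, unfolded mult.assoc])
qed

lemma powi_minus_mult_power:
  fixes q :: complex
  shows "q \<noteq> 0 \<Longrightarrow> q powi (- int n) * q ^ n = 1"
  by (simp only: power_int_minus power_int_of_nat) simp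

text \<open>The prefactor distributes over the product as one factor q^j / w for each j = 1, ..., n,
  and (q^j / w) (1 + w q^(-j)) = 1 + (q / w) q^(j-1).\<close>

lemma qpoch_reflect:
  assumes q: "q \<noteq> 0" and w: "w \<noteq> 0"
  shows "(q / w) ^ n * q powi tri (int n) * qpoch (- (w * q powi (- int n))) q n = qpoch (- (q / w)) q n"
proof (induction n)
  case (Suc n)
  have *: "w * q powi (- int (Suc n)) * q = w * q powi (- int n)"
    using q by (simp only: power_int_minus power_int_of_nat) (simp add: field_simps)
  have t: "q powi tri (int (Suc n)) = q powi tri (int n) * q ^ n"
    using powi_mult_eq[OF q, of "tri (int n)" "int n" "tri (int (Suc n))"] tri_add_1[of "int n"]
    by (simp add: add.commute)
  have "(q / w) * q ^ n * (1 + w * q powi (- int (Suc n))) = 1 + (q / w) * q ^ n"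
    using q w by (simp only: power_int_minus power_int_of_nat) (simp add: field_simps)
  moreover have "(q / w) ^ Suc n * q powi tri (int (Suc n)) * qpoch (- (w * q powi (- int (Suc n)))) q (Suc n)
     = ((q / w) ^ n * q powi tri (int n) * qpoch (- (w * q powi (- int n))) q n) * ((q / w) * q ^ n * (1 + w * q powi (- int (Suc n))))"
    unfolding qpoch_Suc_shift mult_minus_left * t diff_minus_eq_add by (simp only: power_Suc mult_ac)
  ultimately show ?case
    unfolding Suc.IH by (simp add: qpoch_Suc)
qed simp

text \<open>The limit of a finite triple product: \<open>bil\<close> of the theta terms is a product
  by \<open>bil_theta\<close>, and \<open>bil_LIMSEQ\<close> identifies its limit with the theta
  series over (q;q)_inf^2.\<close>

theorem jacobi_triple_product:
  assumes q: "norm q < 1" "q \<noteq> 0" and w: "w \<noteq> 0"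
  shows "((\<lambda>r. w powi r * q powi tri r) has_sum (qpoch_inf (- w) q * qpoch_inf (- (q / w)) q * qpoch_inf q q)) UNIV"
proof -
  let ?f = "\<lambda>r. w powi r * q powi tri r"
  have "bil q 0 n ?f = qpoch (- w) q n * qpoch (- (q / w)) q n * rpoch q (int (2 * n))" for n
  proof -
    \<comment> \<open>The product is cut in the middle: the lower half is reflected to (-q/w;q)_n,
      and the upper half starts at \<open>w\<close>.\<close>
    have "qpoch (- (w * q powi (- int n))) q (2 * n) = qpoch (- (w * q powi (- int n))) q n * qpoch (- w) q n"
      unfolding mult_2 qpoch_add mult_minus_left mult.assoc powi_minus_mult_power[OF q(2)] by simp
    then show ?thesis
      using bil_theta[OF q w, of 0 n] qpoch_reflect[OF q(2) w, of n] by (simp add: mult_ac)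
  qed
  moreover have "(\<lambda>n. rpoch q (int (2 * n))) \<longlonglongrightarrow> 1 / qpoch_inf q q"
  proof -
    have "filterlim (\<lambda>n::nat. 2 * n) sequentially sequentially"
      by (intro filterlim_subseq) (auto simp: strict_mono_def)
    from filterlim_compose[OF LIMSEQ_rpoch[OF q(1), of 0] this] show ?thesis
      by simp
  qed
  ultimately have "(\<lambda>n. bil q 0 n ?f) \<longlonglongrightarrow> qpoch_inf (- w) q * qpoch_inf (- (q / w)) q * (1 / qpoch_inf q q)"
    by (simp only:) (intro tendsto_mult LIMSEQ_qpoch q)
  moreover have s: "(\<lambda>r. norm (?f r)) summable_on UNIV"
    by (rule summable_norm_theta[OF q w])
  then have "(\<lambda>n. bil q 0 n ?f) \<longlonglongrightarrow> infsum ?f UNIV / (qpoch_inf q q)\<^sup>2"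
    by (rule bil_LIMSEQ[OF q(1)])
  ultimately have "infsum ?f UNIV / (qpoch_inf q q)\<^sup>2 = qpoch_inf (- w) q * qpoch_inf (- (q / w)) q * (1 / qpoch_inf q q)"
    by (rule LIMSEQ_unique[rotated])
  then have "infsum ?f UNIV = qpoch_inf (- w) q * qpoch_inf (- (q / w)) q * qpoch_inf q q"
    using qpoch_inf_self_nonzero[OF q(1)] by (simp add: field_simps power2_eq_square)
  then show ?thesis
    using has_sum_infsum[OF abs_summable_summable[OF s]] by simp
qed

text \<open>This is \<open>sum_tri_rpoch\<close> at \<open>2 * n + a\<close>; it evaluates the inner
  sum over \<open>r\<close> of the lattice sum.\<close>

lemma bil_powi_tri:
  assumes q: "norm q < 1" "q \<noteq> 0"
  shows "bil (q\<^sup>2) a n (\<lambda>r. q powi tri (2 * r + int a)) = 1 / qpoch q q (2 * n + a)"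
proof -
  have "2 * (int k - int (n + a)) + int a = 2 * int k - int (2 * n + a)" for k
    by simp
  then show ?thesis
    unfolding bil_conv_sum_atMost using sum_tri_rpoch[OF q, of "2 * n + a"] by (simp only:)
qed

subsection \<open>The Rogers--Ramanujan identities\<close>

text \<open>Bailey's lemma, in its limiting form, for a single kernel entry. With
  \<open>s = r + t\<close> the sum is \<open>q_vandermonde\<close> at offset
  \<open>2 * r + a\<close>.\<close>

lemma bailey_step:
  assumes q: "norm q < 1" "q \<noteq> 0" and a: "a \<le> 1"
  shows "(\<Sum>s\<le>n. q ^ (s * (s + a)) * rpoch q (int n - int s) * (rpoch q (int s - r) * rpoch q (int s + r + int a)))
       = q powi (r * (r + int a)) * (rpoch q (int n - r) * rpoch q (int n + r + int a))"
proof -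
  have nonneg: "(\<Sum>s\<le>n. q ^ (s * (s + a)) * rpoch q (int n - int s) * (rpoch q (int s - int r) * rpoch q (int s + int r + int a)))
       = q powi (int r * (int r + int a)) * (rpoch q (int n - int r) * rpoch q (int n + int r + int a))" for r
  proof (cases "r \<le> n")
    case True
    then have n: "n = r + (n - r)"
      by simp
    have "(\<Sum>s\<le>n. q ^ (s * (s + a)) * rpoch q (int n - int s) * (rpoch q (int s - int r) * rpoch q (int s + int r + int a)))
        = (\<Sum>s\<in>{r..n}. q ^ (s * (s + a)) * rpoch q (int n - int s) * (rpoch q (int s - int r) * rpoch q (int s + int r + int a)))"
      by (rule sum.mono_neutral_right) auto
    also have "\<dots> = (\<Sum>t\<le>n - r. q ^ ((r + t) * (r + t + a)) * rpoch q (int n - int (r + t)) * (rpoch q (int t) * rpoch q (int t + (2 * int r + int a))))"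
      by (rule sum.reindex_bij_witness[of _ "\<lambda>t. r + t" "\<lambda>s. s - r"]) (use True in \<open>auto simp: of_nat_diff algebra_simps\<close>)
    also have "\<dots> = (\<Sum>t\<le>n - r. q powi (int r * (int r + int a)) *
        (q powi (int t * (int t + (2 * int r + int a))) * rpoch q (int t + (2 * int r + int a)) * rpoch q (int t) * rpoch q (int (n - r) - int t)))"
    proof (intro sum.cong refl)
      fix t
      have "q ^ ((r + t) * (r + t + a)) = q powi (int r * (int r + int a)) * q powi (int t * (int t + (2 * int r + int a)))"
        unfolding power_int_of_nat[symmetric] by (intro powi_mult_eq[symmetric] q(2)) (simp add: algebra_simps)
      moreover have "int n - int (r + t) = int (n - r) - int t"
        using True by simp
      ultimately show "q ^ ((r + t) * (r + t + a)) * rpoch q (int n - int (r + t)) * (rpoch q (int t) * rpoch q (int t + (2 * int r + int a)))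
        = q powi (int r * (int r + int a)) * (q powi (int t * (int t + (2 * int r + int a))) * rpoch q (int t + (2 * int r + int a)) * rpoch q (int t) * rpoch q (int (n - r) - int t))"
        by (simp only: mult_ac)
    qed
    also have "\<dots> = q powi (int r * (int r + int a)) * (rpoch q (int (n - r)) * rpoch q (int (n - r) + (2 * int r + int a)))"
      unfolding sum_distrib_left[symmetric] q_vandermonde[OF q] ..
    also have "int (n - r) + (2 * int r + int a) = int n + int r + int a"
      using True by simp
    also have "int (n - r) = int n - int r"
      using True by simp
    finally show ?thesis .
  qed auto
  show ?thesis
  proof (cases "r \<ge> 0")
    case True
    then show ?thesis
      using nonneg[of "nat r"] by simp
  next
    case False
    \<comment> \<open>The reflection of \<open>r\<close> to \<open>- r - a\<close> swaps the two
      kernel factors and fixes \<open>r * (r + a)\<close>. Since \<open>a \<le> 1\<close>, it sends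
      negative \<open>r\<close> to nonnegative ones.\<close>
    define r' where "r' = nat (- r - int a)"
    have r: "int r' = - r - int a"
      using False a by (simp add: r'_def)
    have e: "int s - r = int s + int r' + int a" "int s + r + int a = int s - int r'" for s
      by (simp_all add: r)
    have "r * (r + int a) = int r' * (int r' + int a)"
      by (simp add: r algebra_simps)
    then show ?thesis
      using nonneg[of r'] unfolding e by (simp only: mult_ac)
  qed
qed

lemma bailey_step_sum:
  assumes q: "norm q < 1" "q \<noteq> 0" and a: "a \<le> 1" and "finite R"
  shows "(\<Sum>s\<le>n. q ^ (s * (s + a)) * rpoch q (int n - int s) * (\<Sum>r\<in>R. \<alpha> r * rpoch q (int s - r) * rpoch q (int s + r + int a)))
       = (\<Sum>r\<in>R. (q powi (r * (r + int a)) * \<alpha> r) * rpoch q (int n - r) * rpoch q (int n + r + int a))"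
proof -
  have "(\<Sum>s\<le>n. q ^ (s * (s + a)) * rpoch q (int n - int s) * (\<Sum>r\<in>R. \<alpha> r * rpoch q (int s - r) * rpoch q (int s + r + int a)))
      = (\<Sum>s\<le>n. \<Sum>r\<in>R. \<alpha> r * (q ^ (s * (s + a)) * rpoch q (int n - int s) * (rpoch q (int s - r) * rpoch q (int s + r + int a))))"
    by (simp only: sum_distrib_left mult_ac)
  also have "\<dots> = (\<Sum>r\<in>R. \<alpha> r * (\<Sum>s\<le>n. q ^ (s * (s + a)) * rpoch q (int n - int s) * (rpoch q (int s - r) * rpoch q (int s + r + int a))))"
    by (subst sum.swap) (simp only: sum_distrib_left)
  finally show ?thesis
    unfolding bailey_step[OF q a] by (simp only: mult_ac)
qed

text \<open>One step along the Bailey chain, by linearity from \<open>bailey_step\<close>. The range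
  of \<open>r\<close> belonging to \<open>n\<close> serves all \<open>s \<le> n\<close>, because the
  extra terms vanish.\<close>

lemma bil_step:
  assumes q: "norm q < 1" "q \<noteq> 0" and a: "a \<le> 1"
  shows "bil q a n (\<lambda>r. q powi (r * (r + int a)) * \<alpha> r)
       = (\<Sum>s\<le>n. q ^ (s * (s + a)) * rpoch q (int n - int s) * bil q a s \<alpha>)"
proof -
  have "bil q a s \<alpha> = (\<Sum>r\<in>{- int (n + a)..int n}. \<alpha> r * rpoch q (int s - r) * rpoch q (int s + r + int a))" if "s \<le> n" for s
    unfolding bil_def by (rule sum.mono_neutral_left) (use that in \<open>auto simp: not_le\<close>)
  then show ?thesis
    using bailey_step_sum[OF q a, of "{- int (n + a)..int n}" n \<alpha>] by (simp add: bil_def[of q a n])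
qed

text \<open>The unit Bailey pair. For \<open>n > 0\<close> the product in \<open>bil_theta\<close>
  at \<open>w = -1\<close> reaches the index \<open>n + a < 2 * n + a\<close>, where its factor is 1
  - q^(-(n+a)) q^(n+a) = 0.\<close>

lemma bil_unit:
  assumes q: "norm q < 1" "q \<noteq> 0" and a: "a \<le> 1"
  shows "bil q a n (\<lambda>r. (-1) powi r * q powi tri r) = (if n = 0 then 1 else 0)"
proof (cases "n = 0")
  case True
  consider "a = 0" | "a = 1"
    using a by linarith
  then show ?thesis
  proof cases
    case 2
    have "{-1..0::int} = {-1, 0}"
      by auto
    moreover have "rpoch q 1 = 1 / (1 - q)"
      using rpoch_of_nat[of q 1] by (simp add: qpoch_def)
    moreover have "tri (-1) = 1"
      by (simp add: tri_def)
    ultimately show ?thesis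
      using True 2 power_neq_1[OF q(1), of 1] by (simp add: bil_def field_simps)
  qed (use True in \<open>simp add: bil_def\<close>)
next
  case False
  have "qpoch (q powi (- int (n + a))) q (2 * n + a) = 0"
    unfolding qpoch_def using False powi_minus_mult_power[OF q(2), of "n + a"]
    by (intro prod_zero bexI[of _ "n + a"]) (simp_all del: of_nat_add)
  then show ?thesis
    using False bil_theta[OF q, of "-1" a n] by simp
qed

text \<open>Two chain steps applied to the unit pair, followed by \<open>n\<close> to infinity: one
  side becomes the Rogers-Ramanujan sum over (q;q)_inf, the other a theta series in base q^5 over
  (q;q)_inf^2.\<close>

theorem rogers_ramanujan_theta:
  assumes q: "norm q < 1" "q \<noteq> 0" and a: "a \<le> 1"
  shows "((\<lambda>s. q ^ (s * (s + a)) * rpoch q (int s)) has_sum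
     (qpoch_inf (q ^ (2 + 2 * a)) (q ^ 5) * qpoch_inf (q ^ (3 - 2 * a)) (q ^ 5) * qpoch_inf (q ^ 5) (q ^ 5) / qpoch_inf q q)) UNIV"
proof -
  define \<alpha> where "\<alpha> r = (-1) powi r * q powi tri r" for r
  define \<beta> where "\<beta> r = q powi (r * (r + int a)) * (q powi (r * (r + int a)) * \<alpha> r)" for r
  define f where "f n s = q ^ (s * (s + a)) * rpoch q (int n - int s) * rpoch q (int s)" for n s
  obtain C where C: "C > 0" "\<And>k. norm (rpoch q k) \<le> C"
    using rpoch_bounded[OF q(1)] by blast
  \<comment> \<open>After the first step only \<open>u = 0\<close> survives from the unit pair, so
    the sequence entering the second step is 1/(q;q)_s.\<close>
  have "(\<Sum>u\<le>s. q ^ (u * (u + a)) * rpoch q (int s - int u) * (if u = 0 then 1 else 0)) = rpoch q (int s)" for s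
    by (subst sum.mono_neutral_right[of _ "{0}"]) auto
  then have bil: "bil q a n \<beta> = (\<Sum>s\<le>n. f n s)" for n
    unfolding \<beta>_def \<alpha>_def f_def bil_step[OF q a] bil_unit[OF q a] by (simp only:)
  have "(f n has_sum (\<Sum>s\<le>n. f n s)) UNIV" for n
    by (rule has_sum_finite_neutralI[of "{..n}"]) (auto simp: f_def not_le)
  note fsum = infsumI[OF this]
  have dom: "norm (q ^ (s * (s + a))) \<le> norm q ^ s" for s
    using q(1) unfolding norm_power by (intro power_decreasing) (cases s; auto)+
  have geo: "(\<lambda>s. norm q ^ s) summable_on UNIV"
    using q(1) by (intro norm_summable_imp_summable_on) (simp add: summable_geometric)
  have "(\<lambda>n. infsum (f n) UNIV) \<longlonglongrightarrow> (\<Sum>\<^sub>\<infinity>s. q ^ (s * (s + a)) * (1 / qpoch_inf q q) * rpoch q (int s))"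
  proof (rule infsum_dominated_convergence)
    show "(\<lambda>s. norm q ^ s * (C * C)) summable_on UNIV"
      by (intro summable_on_cmult_left geo)
    show "norm (f n s) \<le> norm q ^ s * (C * C)" for n s
      using C dom[of s] unfolding f_def norm_mult mult.assoc by (intro mult_mono) (auto simp: less_imp_le)
    show "(\<lambda>n. f n s) \<longlonglongrightarrow> q ^ (s * (s + a)) * (1 / qpoch_inf q q) * rpoch q (int s)" for s
      unfolding f_def using LIMSEQ_rpoch[OF q(1), of "- int s"] by (intro tendsto_mult tendsto_const) simp
  qed
  also have "(\<Sum>\<^sub>\<infinity>s. q ^ (s * (s + a)) * (1 / qpoch_inf q q) * rpoch q (int s))
      = (1 / qpoch_inf q q) * (\<Sum>\<^sub>\<infinity>s. q ^ (s * (s + a)) * rpoch q (int s))"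
    by (subst infsum_cmult_right'[symmetric]) (simp add: mult_ac)
  finally have lim1: "(\<lambda>n. bil q a n \<beta>) \<longlonglongrightarrow> (1 / qpoch_inf q q) * (\<Sum>\<^sub>\<infinity>s. q ^ (s * (s + a)) * rpoch q (int s))"
    unfolding bil fsum .
  have q5: "norm (q ^ 5) < 1" "q ^ 5 \<noteq> 0"
    using q by (auto simp: norm_power power_less_one_iff)
  define w where "w = - (q ^ (2 + 2 * a))"
  have w: "w \<noteq> 0"
    using q(2) by (simp add: w_def)
  have \<beta>: "\<beta> r = w powi r * (q ^ 5) powi tri r" for r
  proof -
    have "r * (r + int a) + (r * (r + int a) + tri r) = int (2 + 2 * a) * r + 5 * tri r"
      using tri_double[of r] by (simp add: algebra_simps)
    then have "q powi (r * (r + int a)) * (q powi (r * (r + int a)) * q powi tri r)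
       = q powi (int (2 + 2 * a) * r) * q powi (5 * tri r)"
      using q(2) by (simp only: power_int_add[symmetric] simp_thms)
    moreover have "w powi r = (-1) powi r * q powi (int (2 + 2 * a) * r)"
      unfolding w_def power_int_mult power_int_of_nat power_int_mult_distrib[symmetric] by simp
    moreover have "(q ^ 5) powi tri r = q powi (5 * tri r)"
      by (simp add: power_int_mult)
    moreover have "\<beta> r = (-1) powi r * (q powi (r * (r + int a)) * (q powi (r * (r + int a)) * q powi tri r))"
      unfolding \<beta>_def \<alpha>_def by (simp only: mult_ac)
    ultimately show ?thesis
      by (simp only: mult.assoc)
  qed
  have jtp: "(\<beta> has_sum (qpoch_inf (- w) (q ^ 5) * qpoch_inf (- (q ^ 5 / w)) (q ^ 5) * qpoch_inf (q ^ 5) (q ^ 5))) UNIV"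
    using jacobi_triple_product[OF q5 w] by (simp add: \<beta>[abs_def])
  have "(\<lambda>n. bil q a n \<beta>) \<longlonglongrightarrow> infsum \<beta> UNIV / (qpoch_inf q q)\<^sup>2"
    using summable_norm_theta[OF q5 w] by (intro bil_LIMSEQ q(1)) (simp add: \<beta>)
  with lim1 have "(1 / qpoch_inf q q) * (\<Sum>\<^sub>\<infinity>s. q ^ (s * (s + a)) * rpoch q (int s)) = infsum \<beta> UNIV / (qpoch_inf q q)\<^sup>2"
    by (rule LIMSEQ_unique)
  then have *: "(\<Sum>\<^sub>\<infinity>s. q ^ (s * (s + a)) * rpoch q (int s)) = infsum \<beta> UNIV / qpoch_inf q q"
    using qpoch_inf_self_nonzero[OF q(1)] by (simp add: field_simps power2_eq_square)
  have "2 + 2 * a + (3 - 2 * a) = 5"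
    using a by simp
  then have "q ^ 5 = q ^ (2 + 2 * a) * q ^ (3 - 2 * a)"
    by (simp only: power_add[symmetric])
  then have "- (q ^ 5 / w) = q ^ (3 - 2 * a)"
    using q(2) by (simp add: w_def field_simps)
  then have val: "infsum \<beta> UNIV = qpoch_inf (q ^ (2 + 2 * a)) (q ^ 5) * qpoch_inf (q ^ (3 - 2 * a)) (q ^ 5) * qpoch_inf (q ^ 5) (q ^ 5)"
    using infsumI[OF jtp] by (simp add: w_def)
  have "(\<lambda>s. norm (q ^ (s * (s + a)) * rpoch q (int s))) summable_on UNIV"
  proof (rule Infinite_Sum.abs_summable_on_comparison_test')
    show "(\<lambda>s. norm q ^ s * C) summable_on UNIV"
      by (intro summable_on_cmult_left geo)
    show "norm (q ^ (s * (s + a)) * rpoch q (int s)) \<le> norm q ^ s * C" for s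
      using C dom[of s] unfolding norm_mult by (intro mult_mono) auto
  qed
  from has_sum_infsum[OF abs_summable_summable[OF this]] show ?thesis
    unfolding * val .
qed

text \<open>Splitting (q;q)_inf by residues modulo 5 cancels the three products in the numerator and
  leaves the residues 1, 4 or 2, 3.\<close>

theorem rogers_ramanujan:
  assumes q: "norm q < 1" "q \<noteq> 0" and a: "a \<le> 1"
  shows "((\<lambda>s. q ^ (s * (s + a)) * rpoch q (int s)) has_sum
     (1 / (qpoch_inf (q ^ (1 + a)) (q ^ 5) * qpoch_inf (q ^ (4 - a)) (q ^ 5)))) UNIV"
proof -
  define P where "P j = qpoch_inf (q ^ j) (q ^ 5)" for j
  have "qpoch_inf q q = (\<Prod>j<5. qpoch_inf (q * q ^ j) (q ^ 5))"
    by (rule qpoch_inf_dissect[OF q(1)]) simp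
  also have "\<dots> = P 1 * P 2 * P 3 * P 4 * P 5"
    by (simp add: P_def eval_nat_numeral)
  finally have *: "qpoch_inf q q = \<dots>" .
  consider "a = 0" | "a = 1"
    using a by linarith
  then have "P (2 + 2 * a) * P (3 - 2 * a) * P 5 / qpoch_inf q q = 1 / (P (1 + a) * P (4 - a))"
    using qpoch_inf_self_nonzero[OF q(1)] unfolding * by cases (auto simp: field_simps eval_nat_numeral)
  then show ?thesis
    using rogers_ramanujan_theta[OF q a] unfolding P_def by simp
qed

subsection \<open>Summation over the lattice\<close>

lemma summable_on_prod_real:
  fixes f :: "'a \<Rightarrow> real" and g :: "'b \<Rightarrow> real"
  assumes "f summable_on A" "g summable_on B" "\<And>x. x \<in> A \<Longrightarrow> f x \<ge> 0" "\<And>y. y \<in> B \<Longrightarrow> g y \<ge> 0"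
  shows "(\<lambda>(x, y). f x * g y) summable_on A \<times> B"
proof (rule summable_on_SigmaI)
  show "((\<lambda>y. case (x, y) of (x, y) \<Rightarrow> f x * g y) has_sum f x * infsum g B) B" for x
    using assms(2) by (auto intro!: has_sum_cmult_right has_sum_infsum)
  show "(\<lambda>x. f x * infsum g B) summable_on A"
    by (intro summable_on_cmult_left assms(1))
qed (use assms in auto)

text \<open>Euler's expansion, obtained by letting \<open>n\<close> tend to infinity in the
  q-binomial theorem and cancelling 1/(q;q)_inf.\<close>

lemma euler_qpoch_inf:
  assumes q: "norm q < 1" "q \<noteq> 0"
  shows "((\<lambda>k. x ^ k * q powi tri (int k) * rpoch q (int k)) has_sum qpoch_inf (- x) q) UNIV"
proof -
  define f where "f n k = x ^ k * q powi tri (int k) * rpoch q (int k) * rpoch q (int n - int k)" for n k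
  define h where "h k = x ^ k * q powi tri (int k) * rpoch q (int k)" for k
  obtain C where C: "C > 0" "\<And>k. norm (rpoch q k) \<le> C"
    using rpoch_bounded[OF q(1)] by blast
  have s: "(\<lambda>k. norm (x ^ k * q powi tri (int k))) summable_on UNIV"
    using summable_norm_theta_nat[OF q, of x] by (intro norm_summable_imp_summable_on) simp
  have sh: "(\<lambda>k. norm (h k)) summable_on UNIV"
  proof (rule Infinite_Sum.abs_summable_on_comparison_test')
    show "(\<lambda>k. norm (x ^ k * q powi tri (int k)) * C) summable_on UNIV"
      by (intro summable_on_cmult_left s)
    show "norm (h k) \<le> norm (x ^ k * q powi tri (int k)) * C" for k
      unfolding h_def norm_mult[of "x ^ k * q powi tri (int k)"] using C by (intro mult_left_mono) auto
  qed
  have "(f n has_sum (\<Sum>k\<le>n. f n k)) UNIV" for n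
    by (rule has_sum_finite_neutralI[of "{..n}"]) (auto simp: f_def not_le)
  then have fsum: "infsum (f n) UNIV = qpoch (- x) q n * rpoch q (int n)" for n
    unfolding f_def q_binomial[OF q] by (rule infsumI)
  have "(\<lambda>n. infsum (f n) UNIV) \<longlonglongrightarrow> (\<Sum>\<^sub>\<infinity>k. h k * (1 / qpoch_inf q q))"
  proof (rule infsum_dominated_convergence)
    show "(\<lambda>k. norm (h k) * C) summable_on UNIV"
      by (intro summable_on_cmult_left sh)
    show "norm (f n k) \<le> norm (h k) * C" for n k
      unfolding f_def h_def[symmetric] norm_mult[of "h k"] using C by (intro mult_left_mono) auto
    show "(\<lambda>n. f n k) \<longlonglongrightarrow> h k * (1 / qpoch_inf q q)" for k
      unfolding f_def h_def[symmetric] using LIMSEQ_rpoch[OF q(1), of "- int k"] by (intro tendsto_mult tendsto_const) simp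
  qed
  moreover have "(\<lambda>n. infsum (f n) UNIV) \<longlonglongrightarrow> qpoch_inf (- x) q * (1 / qpoch_inf q q)"
    unfolding fsum using LIMSEQ_rpoch[OF q(1), of 0] by (intro tendsto_mult LIMSEQ_qpoch q(1)) simp
  ultimately have "(\<Sum>\<^sub>\<infinity>k. h k * (1 / qpoch_inf q q)) = qpoch_inf (- x) q * (1 / qpoch_inf q q)"
    by (rule LIMSEQ_unique)
  then have "infsum h UNIV = qpoch_inf (- x) q"
    using qpoch_inf_self_nonzero[OF q(1)] by (subst (asm) infsum_cmult_left') simp
  then show ?thesis
    using has_sum_infsum[OF abs_summable_summable[OF sh]] by (simp add: h_def[abs_def])
qed

lemma qpoch_inf_split:
  assumes q: "norm q < 1"
  shows "qpoch_inf a q = qpoch a q n * qpoch_inf (a * q ^ n) q"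
proof (rule LIMSEQ_unique)
  show "(\<lambda>m. qpoch a q (m + n)) \<longlonglongrightarrow> qpoch_inf a q"
    by (rule LIMSEQ_ignore_initial_segment[OF LIMSEQ_qpoch[OF q]])
  show "(\<lambda>m. qpoch a q (m + n)) \<longlonglongrightarrow> qpoch a q n * qpoch_inf (a * q ^ n) q"
    unfolding add.commute[of _ n] qpoch_add by (intro tendsto_intros LIMSEQ_qpoch q)
qed

text \<open>Odd and even powers of \<open>q\<close> are separated; for \<open>a = 1\<close> there is
  one more odd power than even ones.\<close>

lemma qpoch_bisect:
  assumes "a \<le> 1"
  shows "qpoch q q (2 * n + a) = qpoch q (q\<^sup>2) (n + a) * qpoch (q\<^sup>2) (q\<^sup>2) n"
proof -
  have "{..<2::nat} = {0, 1}"
    by auto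
  then have even: "qpoch q q (2 * n) = qpoch q (q\<^sup>2) n * qpoch (q\<^sup>2) (q\<^sup>2) n"
    by (simp add: qpoch_dissect power2_eq_square)
  consider "a = 0" | "a = 1"
    using assms by linarith
  then show ?thesis
    by cases (simp_all add: qpoch_Suc even power_mult)
qed

text \<open>Both sides of the next identity arise from one double sum, with terms
  \<open>(-1)\<^sup>k q\<^bsup>(n+k)(n+k+2a)\<^esup> / ((q\<^sup>2;q\<^sup>2)\<^sub>n (q\<^sup>2;q\<^sup>2)\<^sub>k)\<close>: summing over \<open>k\<close> first gives the left-hand side
  by Euler, summing over the antidiagonals gives a Rogers--Ramanujan sum in \<open>q\<^sup>4\<close>.\<close>

lemma sum_qpoch_doubled:
  assumes q: "norm q < 1" "q \<noteq> 0" and a: "a \<le> 1"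
    and R: "((\<lambda>s. (q ^ 4) ^ (s * (s + a)) * rpoch (q ^ 4) (int s)) has_sum R) UNIV"
  shows "((\<lambda>n. q ^ (n * (n + 2 * a)) / qpoch q q (2 * n + a)) has_sum (R * qpoch_inf (q\<^sup>2) (q\<^sup>2) / qpoch_inf q q)) UNIV"
proof -
  define p where "p = q\<^sup>2"
  have p: "norm p < 1" "p \<noteq> 0"
    using q by (simp_all add: p_def norm_power abs_square_less_1)
  define G where "G = (\<lambda>(n, k). q ^ ((n + k) * (n + k + 2 * a)) * (-1) ^ k * rpoch p (int n) * rpoch p (int k))"
  obtain C where C: "C > 0" "\<And>k. norm (rpoch p k) \<le> C"
    using rpoch_bounded[OF p(1)] by blast
  have geo: "(\<lambda>s::nat. norm q ^ s * C) summable_on UNIV"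
    using q(1) by (intro summable_on_cmult_left norm_summable_imp_summable_on) (simp add: summable_geometric)
  have "(\<lambda>x. norm (G x)) summable_on UNIV \<times> UNIV"
  proof (rule Infinite_Sum.abs_summable_on_comparison_test')
    show "(\<lambda>(n, k). (norm q ^ n * C) * (norm q ^ k * C)) summable_on UNIV \<times> UNIV"
      by (intro summable_on_prod_real geo) (use C in auto)
    show "norm (G x) \<le> (case x of (n, k) \<Rightarrow> (norm q ^ n * C) * (norm q ^ k * C))" for x
    proof (cases x)
      case (Pair n k)
      have "n + k \<le> (n + k) * (n + k + 2 * a)"
        by (cases "n + k") auto
      then have "norm q ^ ((n + k) * (n + k + 2 * a)) \<le> norm q ^ n * norm q ^ k"
        using q(1) unfolding power_add[symmetric] by (intro power_decreasing) auto
      then have "norm q ^ ((n + k) * (n + k + 2 * a)) * (norm (rpoch p (int n)) * norm (rpoch p (int k))) \<le> (norm q ^ n * norm q ^ k) * (C * C)"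
        using C by (intro mult_mono) (auto simp: less_imp_le)
      then show ?thesis
        by (simp add: Pair G_def norm_mult norm_power mult_ac)
    qed
  qed
  then have sG: "G summable_on UNIV \<times> UNIV"
    by (rule abs_summable_summable)
  define E where "E = qpoch_inf q p"
  have "((\<lambda>k. G (n, k)) has_sum (q ^ (n * (n + 2 * a)) / qpoch q q (2 * n + a) * E)) UNIV" for n
  proof -
    \<comment> \<open>The tail of \<open>E\<close>, that is of (q;q^2)_inf, after its first
      \<open>n + a\<close> factors starts at this power of \<open>q\<close>. Its Euler expansion
      completes the exponent n(n+2a) to (n+k)(n+k+2a).\<close>
    define x where "x = q ^ (2 * (n + a) + 1)"
    have "((\<lambda>k. q ^ (n * (n + 2 * a)) * rpoch p (int n) * ((- x) ^ k * p powi tri (int k) * rpoch p (int k)))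
        has_sum (q ^ (n * (n + 2 * a)) * rpoch p (int n) * qpoch_inf x p)) UNIV"
      using has_sum_cmult_right[OF euler_qpoch_inf[OF p, of "- x"]] by simp
    moreover have "q ^ (n * (n + 2 * a)) * rpoch p (int n) * ((- x) ^ k * p powi tri (int k) * rpoch p (int k)) = G (n, k)" for k
    proof -
      have "p powi tri (int k) = q powi (2 * tri (int k))"
        unfolding p_def power_int_mult by simp
      then have "p powi tri (int k) = q powi (int k * (int k - 1))"
        by (simp only: tri_double)
      moreover have "(- x) ^ k = (-1) ^ k * q ^ ((2 * (n + a) + 1) * k)"
        unfolding x_def power_mult by (rule power_minus)
      moreover have "q ^ (n * (n + 2 * a)) * (q ^ ((2 * (n + a) + 1) * k) * q powi (int k * (int k - 1))) = q ^ ((n + k) * (n + k + 2 * a))"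
        using q(2) by (simp only: power_int_of_nat[symmetric] power_int_add[symmetric] simp_thms)
          (simp add: algebra_simps)
      ultimately show ?thesis
        by (simp add: G_def flip: \<open>_ = q ^ ((n + k) * (n + k + 2 * a))\<close>)
    qed
    moreover have "q ^ (n * (n + 2 * a)) * rpoch p (int n) * qpoch_inf x p = q ^ (n * (n + 2 * a)) / qpoch q q (2 * n + a) * E"
    proof -
      have "x = q * p ^ (n + a)"
        unfolding x_def p_def power_mult[symmetric] by simp
      then have "E = qpoch q p (n + a) * qpoch_inf x p"
        unfolding E_def using qpoch_inf_split[OF p(1), of q "n + a"] by simp
      moreover have "qpoch q q (2 * n + a) = qpoch q p (n + a) * qpoch p p n"
        unfolding p_def by (rule qpoch_bisect[OF a])
      ultimately show ?thesis
        using qpoch_self_nonzero[OF q(1), of "2 * n + a"] by (simp add: rpoch_of_nat)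
    qed
    ultimately show ?thesis
      by simp
  qed
  then have 1: "((\<lambda>n. q ^ (n * (n + 2 * a)) / qpoch q q (2 * n + a) * E) has_sum infsum G (UNIV \<times> UNIV)) UNIV"
    by (rule has_sum_SigmaD[OF has_sum_infsum[OF sG]])
  \<comment> \<open>Regrouping along the antidiagonals \<open>M = n + k\<close>: the power of
    \<open>q\<close> depends on \<open>M\<close> only, so the inner sum is Gauss's alternating
    sum.\<close>
  have "((\<lambda>(M, k). G (M - k, k)) has_sum infsum G (UNIV \<times> UNIV)) (SIGMA M:UNIV. {..M})
      \<longleftrightarrow> (G has_sum infsum G (UNIV \<times> UNIV)) (UNIV \<times> UNIV)"
    by (rule has_sum_reindex_bij_witness[of _ "\<lambda>(n, k). (n + k, k)" "\<lambda>(M, k). (M - k, k)"]) auto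
  then have "((\<lambda>(M, k). G (M - k, k)) has_sum infsum G (UNIV \<times> UNIV)) (SIGMA M:UNIV. {..M})"
    using has_sum_infsum[OF sG] by simp
  from has_sum_SigmaD[OF this, of "\<lambda>M. \<Sum>k\<le>M. G (M - k, k)"]
  have "((\<lambda>M. \<Sum>k\<le>M. G (M - k, k)) has_sum infsum G (UNIV \<times> UNIV)) UNIV"
    by simp
  moreover have "(\<Sum>k\<le>M. G (M - k, k)) = q ^ (M * (M + 2 * a)) * (if even M then rpoch (p\<^sup>2) (int (M div 2)) else 0)" for M
    unfolding sum_alternating_rpoch[OF p(1), symmetric] sum_distrib_left
    by (intro sum.cong) (auto simp: G_def of_nat_diff mult_ac)
  ultimately have "((\<lambda>M. q ^ (M * (M + 2 * a)) * (if even M then rpoch (p\<^sup>2) (int (M div 2)) else 0)) has_sum infsum G (UNIV \<times> UNIV)) UNIV"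
    by simp
  \<comment> \<open>Only even \<open>M = 2 * s\<close> contribute, with exponent 4 s (s + a), which
    explains the base q^4.\<close>
  also have "?this \<longleftrightarrow> ((\<lambda>M. q ^ (M * (M + 2 * a)) * rpoch (p\<^sup>2) (int (M div 2))) has_sum infsum G (UNIV \<times> UNIV)) (range (\<lambda>s. 2 * s))"
    by (rule has_sum_cong_neutral) (auto elim!: evenE)
  also have "\<dots> \<longleftrightarrow> ((\<lambda>s. (q ^ 4) ^ (s * (s + a)) * rpoch (q ^ 4) (int s)) has_sum infsum G (UNIV \<times> UNIV)) UNIV"
  proof (subst has_sum_reindex)
    have "q ^ (2 * s * (2 * s + 2 * a)) = (q ^ 4) ^ (s * (s + a))" for s
      unfolding power_mult[symmetric] by (simp add: algebra_simps)
    moreover have "p\<^sup>2 = q ^ 4"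
      by (simp add: p_def)
    ultimately show "(((\<lambda>M. q ^ (M * (M + 2 * a)) * rpoch (p\<^sup>2) (int (M div 2))) \<circ> (*) 2) has_sum infsum G (UNIV \<times> UNIV)) UNIV
      \<longleftrightarrow> ((\<lambda>s. (q ^ 4) ^ (s * (s + a)) * rpoch (q ^ 4) (int s)) has_sum infsum G (UNIV \<times> UNIV)) UNIV"
      by (simp add: o_def)
  qed (auto simp: inj_def)
  finally have R': "infsum G (UNIV \<times> UNIV) = R"
    using R by (rule has_sum_unique)
  have EE: "qpoch_inf q q = E * qpoch_inf p p"
  proof -
    have "{..<2::nat} = {0, 1}"
      by auto
    then show ?thesis
      using qpoch_inf_dissect[OF q(1), of 2 q] by (simp add: E_def p_def power2_eq_square)
  qed
  then have "E \<noteq> 0" "qpoch_inf p p \<noteq> 0"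
    using qpoch_inf_self_nonzero[OF q(1)] by auto
  then have "((\<lambda>n. q ^ (n * (n + 2 * a)) / qpoch q q (2 * n + a)) has_sum (R / E)) UNIV"
    using 1 has_sum_cmult_left_iff[of E] unfolding R' by blast
  moreover have "R / E = R * qpoch_inf p p / qpoch_inf q q"
    using \<open>E \<noteq> 0\<close> \<open>qpoch_inf p p \<noteq> 0\<close> by (simp add: EE)
  ultimately show ?thesis
    by (simp add: p_def)
qed

section \<open>Theta series with exponents \<open>tri (2 * r + a)\<close>\<close>

lemma tri_linear:
  assumes "a \<le> 1"
  shows "tri (2 * r + int a) = 4 * tri r + int (1 + 2 * a) * r"
proof -
  consider "a = 0" | "a = 1"
    using assms by linarith
  then have "2 * tri (2 * r + int a) = 2 * (4 * tri r + int (1 + 2 * a) * r)"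
    unfolding distrib_left mult.left_commute[of 2 4] tri_double
    by cases (simp_all add: algebra_simps)
  then show ?thesis
    by simp
qed

text \<open>By \<open>tri_linear\<close> these are theta terms in base q^4 with w =
  q^(1+2a).\<close>

lemma summable_norm_powi_tri:
  assumes q: "norm q < 1" "q \<noteq> (0::complex)" and a: "a \<le> 1"
  shows "(\<lambda>r. norm (q powi tri (2 * r + int a))) summable_on UNIV"
proof -
  have "norm (q ^ 4) < 1" "q ^ 4 \<noteq> 0" "q ^ (1 + 2 * a) \<noteq> 0"
    using q by (auto simp: norm_power power_less_one_iff)
  from summable_norm_theta[OF this]
  have "(\<lambda>r. norm ((q ^ (1 + 2 * a)) powi r * (q ^ 4) powi tri r)) summable_on UNIV" .
  moreover have "(q ^ (1 + 2 * a)) powi r * (q ^ 4) powi tri r = q powi tri (2 * r + int a)" for r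
    unfolding tri_linear[OF a] power_int_power by (intro powi_mult_eq q(2)) simp
  ultimately show ?thesis
    by simp
qed

text \<open>Gauss's theta series over the triangular numbers r(2r-1). Its value comes from comparing
  the limits of the two sides of \<open>bil_powi_tri\<close>.\<close>

lemma has_sum_powi_tri:
  assumes q: "norm q < 1" "q \<noteq> (0::complex)"
  shows "((\<lambda>r. q powi tri (2 * r)) has_sum (qpoch_inf (q\<^sup>2) (q\<^sup>2))\<^sup>2 / qpoch_inf q q) UNIV"
proof -
  have p: "norm (q\<^sup>2) < 1"
    using q by (simp add: norm_power abs_square_less_1)
  have s: "(\<lambda>r. norm (q powi tri (2 * r))) summable_on UNIV"
    using summable_norm_powi_tri[OF q, of 0] by simp
  have "(\<lambda>n. bil (q\<^sup>2) 0 n (\<lambda>r. q powi tri (2 * r))) \<longlonglongrightarrow> infsum (\<lambda>r. q powi tri (2 * r)) UNIV / (qpoch_inf (q\<^sup>2) (q\<^sup>2))\<^sup>2"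
    by (rule bil_LIMSEQ[OF p s])
  moreover have "(\<lambda>n. bil (q\<^sup>2) 0 n (\<lambda>r. q powi tri (2 * r))) \<longlonglongrightarrow> 1 / qpoch_inf q q"
  proof -
    have "filterlim (\<lambda>n::nat. 2 * n) sequentially sequentially"
      by (intro filterlim_subseq) (auto simp: strict_mono_def)
    from filterlim_compose[OF LIMSEQ_qpoch[OF q(1), of q] this]
    have "(\<lambda>n. 1 / qpoch q q (2 * n)) \<longlonglongrightarrow> 1 / qpoch_inf q q"
      by (intro tendsto_intros qpoch_inf_self_nonzero q)
    then show ?thesis
      using bil_powi_tri[OF q, of 0] by simp
  qed
  ultimately have "infsum (\<lambda>r. q powi tri (2 * r)) UNIV / (qpoch_inf (q\<^sup>2) (q\<^sup>2))\<^sup>2 = 1 / qpoch_inf q q"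
    by (rule LIMSEQ_unique)
  then have "infsum (\<lambda>r. q powi tri (2 * r)) UNIV = (qpoch_inf (q\<^sup>2) (q\<^sup>2))\<^sup>2 / qpoch_inf q q"
    using qpoch_inf_self_nonzero[OF p] by (simp add: field_simps)
  then show ?thesis
    using has_sum_infsum[OF abs_summable_summable[OF s]] by simp
qed

text \<open>Here \<open>q\<close> is a square root of the base of the four identities. Letting
  \<open>r\<close> run over all integers is harmless, since \<open>rpoch\<close> leaves finitely
  many nonzero terms for each \<open>n\<close>.\<close>

definition lattice_term :: "complex \<Rightarrow> nat \<Rightarrow> nat \<times> int \<Rightarrow> complex" where
  "lattice_term q a = (\<lambda>(n, r). q ^ (n * (n + 2 * a)) *
     (q powi tri (2 * r + int a) * rpoch (q\<^sup>2) (int n - r) * rpoch (q\<^sup>2) (int n + r + int a)))"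

text \<open>Summing over \<open>r\<close> first gives 1/(q;q)_(2n+a), and
  \<open>sum_qpoch_doubled\<close> handles the rest. The value is written with the theta series
  because that is its only factor that changes under \<open>q\<close> to \<open>- q\<close>: the
  others depend on q^2 and q^4.\<close>

lemma has_sum_lattice_term:
  assumes q: "norm q < 1" "q \<noteq> 0" and a: "a \<le> 1"
    and R: "((\<lambda>s. (q ^ 4) ^ (s * (s + a)) * rpoch (q ^ 4) (int s)) has_sum R) UNIV"
  shows "(lattice_term q a has_sum (R / qpoch_inf (q\<^sup>2) (q\<^sup>2) * infsum (\<lambda>r. q powi tri (2 * r)) UNIV)) (UNIV \<times> UNIV)"
proof -
  define p where "p = q\<^sup>2"
  have p: "norm p < 1" "p \<noteq> 0"
    using q by (simp_all add: p_def norm_power abs_square_less_1)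
  obtain C where C: "C > 0" "\<And>k. norm (rpoch p k) \<le> C"
    using rpoch_bounded[OF p(1)] by blast
  have "(\<lambda>x. norm (lattice_term q a x)) summable_on UNIV \<times> UNIV"
  proof (rule Infinite_Sum.abs_summable_on_comparison_test')
    have "(\<lambda>s. norm q ^ s) summable_on UNIV"
      using q(1) by (intro norm_summable_imp_summable_on) (simp add: summable_geometric)
    moreover have "(\<lambda>r. norm (q powi tri (2 * r + int a)) * (C * C)) summable_on UNIV"
      by (intro summable_on_cmult_left summable_norm_powi_tri q a)
    ultimately show "(\<lambda>(n, r). norm q ^ n * (norm (q powi tri (2 * r + int a)) * (C * C))) summable_on UNIV \<times> UNIV"
      by (rule summable_on_prod_real) (use C in auto)
    show "norm (lattice_term q a x) \<le> (case x of (n, r) \<Rightarrow> norm q ^ n * (norm (q powi tri (2 * r + int a)) * (C * C)))" for x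
    proof (cases x)
      case (Pair n r)
      have "n \<le> n * (n + 2 * a)"
        by (cases n) auto
      then have "norm q ^ (n * (n + 2 * a)) \<le> norm q ^ n"
        using q(1) by (intro power_decreasing) auto
      then show ?thesis
        using C unfolding Pair lattice_term_def prod.case p_def[symmetric] norm_mult norm_power mult.assoc
        by (intro mult_mono) (auto simp: less_imp_le)
    qed
  qed
  then have s: "lattice_term q a summable_on UNIV \<times> UNIV"
    by (rule abs_summable_summable)
  have inner: "((\<lambda>r. lattice_term q a (n, r)) has_sum (q ^ (n * (n + 2 * a)) / qpoch q q (2 * n + a))) UNIV" for n
    using has_sum_cmult_right[OF has_sum_bil[of "\<lambda>r. q powi tri (2 * r + int a)" "q\<^sup>2" n a], of "q ^ (n * (n + 2 * a))"]
    unfolding bil_powi_tri[OF q] lattice_term_def prod.case by simp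
  have "(lattice_term q a has_sum (R * qpoch_inf p p / qpoch_inf q q)) (UNIV \<times> UNIV)"
    using sum_qpoch_doubled[OF q a R] s unfolding p_def by (rule has_sum_SigmaI[OF inner])
  moreover have "R * qpoch_inf p p / qpoch_inf q q = R / qpoch_inf p p * infsum (\<lambda>r. q powi tri (2 * r)) UNIV"
    using qpoch_inf_self_nonzero[OF p(1)] unfolding infsumI[OF has_sum_powi_tri[OF q]] p_def[symmetric]
    by (simp add: power2_eq_square)
  ultimately show ?thesis
    by (simp add: p_def)
qed

subsection \<open>Splitting by parity\<close>

text \<open>\<open>(f + g) / 2\<close> agrees with \<open>f\<close> on \<open>P\<close> and vanishes
  elsewhere; \<open>(f - g) / 2\<close> does so on the complement.\<close>

lemma has_sum_split_sign:
  fixes f g :: "'a \<Rightarrow> complex"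
  assumes f: "(f has_sum A) UNIV" and g: "(g has_sum B) UNIV"
    and fg: "\<And>x. g x = (if x \<in> P then f x else - f x)"
  shows "(f has_sum ((A + B) / 2)) P" "(f has_sum ((A - B) / 2)) (- P)"
proof -
  have "((\<lambda>x. (f x + g x) / 2) has_sum ((A + B) / 2)) UNIV"
    by (intro has_sum_divide_const has_sum_add f g)
  also have "?this \<longleftrightarrow> (f has_sum ((A + B) / 2)) P"
    by (rule has_sum_cong_neutral) (auto simp: fg)
  finally show "(f has_sum ((A + B) / 2)) P" .
  have "((\<lambda>x. (f x + - g x) / 2) has_sum ((A + - B) / 2)) UNIV"
    by (intro has_sum_divide_const has_sum_add has_sum_uminusI f g)
  also have "?this \<longleftrightarrow> (f has_sum ((A + - B) / 2)) (- P)"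
    by (rule has_sum_cong_neutral) (auto simp: fg)
  finally show "(f has_sum ((A - B) / 2)) (- P)"
    by simp
qed

lemma powi_minus_base:
  fixes q :: complex
  shows "(- q) powi k = (if even k then q powi k else - (q powi k))"
  using power_int_mult_distrib[of "-1" q k] by (simp add: power_int_minus_one_minus)

lemma even_tri_linear: "a \<le> 1 \<Longrightarrow> even (tri (2 * r + int a)) \<longleftrightarrow> even r"
  by (simp add: tri_linear)

text \<open>\<open>tri (2 * r)\<close> has the parity of \<open>r\<close>, so the even and odd parts
  in \<open>q\<close> are the sums over \<open>r = 2 * k\<close> and \<open>r = 2 * k + 1\<close>.
  There the exponents are 6k + 16 tri(k) and 1 + 14k + 16 tri(k), each a triple product in base
  q^16.\<close>

lemma theta_split:
  assumes q: "norm q < 1" "q \<noteq> (0::complex)"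
  defines "T \<equiv> \<lambda>q. infsum (\<lambda>r. q powi tri (2 * r)) UNIV"
    and "s \<equiv> q ^ 16"
  shows "(T q + T (- q)) / 2 = qpoch_inf (- (q ^ 6)) s * qpoch_inf (- (q ^ 10)) s * qpoch_inf s s"
    and "(T q - T (- q)) / 2 = q * (qpoch_inf (- (q ^ 14)) s * qpoch_inf (- (q ^ 2)) s * qpoch_inf s s)"
proof -
  have s: "norm s < 1" "s \<noteq> 0"
    using q by (auto simp: s_def norm_power power_less_one_iff)
  have T: "((\<lambda>r. q powi tri (2 * r)) has_sum T q) UNIV" if "norm q < 1" "q \<noteq> 0" for q
    unfolding T_def using has_sum_imp_summable[OF has_sum_powi_tri[OF that]] by (rule has_sum_infsum)
  have T': "((\<lambda>r. (- q) powi tri (2 * r)) has_sum T (- q)) UNIV"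
    using T[of "- q"] q by simp
  have sign: "(- q) powi tri (2 * r) = (if r \<in> {r. even r} then q powi tri (2 * r) else - (q powi tri (2 * r)))" for r
    using even_tri_linear[of 0 r] by (simp add: powi_minus_base)
  note split = has_sum_split_sign[OF T[OF q] T' sign]
  have "((\<lambda>r. q powi tri (2 * r)) has_sum ((T q + T (- q)) / 2)) {r. even r} \<longleftrightarrow>
      ((\<lambda>k. q powi tri (2 * (2 * k))) has_sum ((T q + T (- q)) / 2)) UNIV"
    by (rule has_sum_reindex_bij_witness[of _ "\<lambda>k. 2 * k" "\<lambda>r. r div 2"]) auto
  moreover have "q powi tri (2 * (2 * k)) = (q ^ 6) powi k * s powi tri k" for k
  proof -
    have "2 * (6 * k + 16 * tri k) = 2 * tri (2 * (2 * k))"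
      unfolding distrib_left mult.left_commute[of 2 16] tri_double by (simp add: algebra_simps)
    then show ?thesis
      unfolding s_def power_int_power by (intro powi_mult_eq[symmetric] q(2)) simp
  qed
  ultimately have "((\<lambda>k. (q ^ 6) powi k * s powi tri k) has_sum ((T q + T (- q)) / 2)) UNIV"
    using split(1) by simp
  moreover have "s / q ^ 6 = q ^ 10"
    unfolding s_def using q(2) power_diff[of q 6 16] by simp
  ultimately show "(T q + T (- q)) / 2 = qpoch_inf (- (q ^ 6)) s * qpoch_inf (- (q ^ 10)) s * qpoch_inf s s"
    using has_sum_unique[OF _ jacobi_triple_product[OF s, of "q ^ 6"]] q(2) by simp
  have "((\<lambda>r. q powi tri (2 * r)) has_sum ((T q - T (- q)) / 2)) (- {r. even r}) \<longleftrightarrow>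
      ((\<lambda>k. q powi tri (2 * (2 * k + 1))) has_sum ((T q - T (- q)) / 2)) UNIV"
    by (rule has_sum_reindex_bij_witness[of _ "\<lambda>k. 2 * k + 1" "\<lambda>r. r div 2"]) auto
  moreover have "q powi tri (2 * (2 * k + 1)) = q * ((q ^ 14) powi k * s powi tri k)" for k
  proof -
    have "2 * (1 + (14 * k + 16 * tri k)) = 2 * tri (2 * (2 * k + 1))"
      unfolding distrib_left[of 2 _ "_ + _"] distrib_left[of 2 "14 * k"] mult.left_commute[of 2 16] tri_double
      by (simp add: algebra_simps)
    then have "1 + (14 * k + 16 * tri k) = tri (2 * (2 * k + 1))"
      by (subst (asm) mult_cancel_left) simp
    then have "q powi 1 * (q powi (14 * k) * q powi (16 * tri k)) = q powi tri (2 * (2 * k + 1))"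
      using q(2) by (simp only: power_int_add[symmetric] simp_thms)
    then show ?thesis
      unfolding s_def power_int_power by simp
  qed
  ultimately have "((\<lambda>k. q * ((q ^ 14) powi k * s powi tri k)) has_sum ((T q - T (- q)) / 2)) UNIV"
    using split(2) by simp
  moreover have "s / q ^ 14 = q ^ 2"
    unfolding s_def using q(2) power_diff[of q 14 16] by simp
  ultimately show "(T q - T (- q)) / 2 = q * (qpoch_inf (- (q ^ 14)) s * qpoch_inf (- (q ^ 2)) s * qpoch_inf s s)"
    using has_sum_unique[OF _ has_sum_cmult_right[OF jacobi_triple_product[OF s, of "q ^ 14"], of q]] q(2) by simp
qed

text \<open>Changing \<open>q\<close> to \<open>- q\<close> multiplies the term at (n, r) by
  (-1)^(n-r). Half the sum and half the difference of the two totals therefore select the parity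
  classes, and \<open>theta_split\<close> evaluates them.\<close>

lemma has_sum_lattice_term_parity:
  assumes q: "norm q < 1" "q \<noteq> 0" and a: "a \<le> 1" and e: "e \<le> 1"
  defines "p \<equiv> q\<^sup>2"
  shows "(lattice_term q a has_sum
     (q ^ e * (qpoch_inf (- (p ^ (3 + 4 * e))) (p ^ 8) * qpoch_inf (- (p ^ (5 - 4 * e))) (p ^ 8) * qpoch_inf (p ^ 8) (p ^ 8)
      / (qpoch_inf p p * (qpoch_inf (p ^ (2 + 2 * a)) (p ^ 10) * qpoch_inf (p ^ (8 - 2 * a)) (p ^ 10))))))
     {(n, r). even (int n - r) \<longleftrightarrow> even e}"
proof -
  define P where "P = {(n, r). even (int n - r)}"
  define R where "R = 1 / (qpoch_inf ((q ^ 4) ^ (1 + a)) ((q ^ 4) ^ 5) * qpoch_inf ((q ^ 4) ^ (4 - a)) ((q ^ 4) ^ 5))"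
  have "norm (q ^ 4) < 1" "q ^ 4 \<noteq> 0"
    using q by (auto simp: norm_power power_less_one_iff)
  from rogers_ramanujan[OF this a]
  have RR: "((\<lambda>s. (q ^ 4) ^ (s * (s + a)) * rpoch (q ^ 4) (int s)) has_sum R) UNIV"
    unfolding R_def .
  have L: "(lattice_term q a has_sum (R / qpoch_inf p p * infsum (\<lambda>r. q powi tri (2 * r)) UNIV)) UNIV"
    using has_sum_lattice_term[OF q a RR] by (simp add: p_def)
  have "norm (- q) < 1" "- q \<noteq> 0"
    using q by auto
  from has_sum_lattice_term[OF this a] RR
  have L': "(lattice_term (- q) a has_sum (R / qpoch_inf p p * infsum (\<lambda>r. (- q) powi tri (2 * r)) UNIV)) UNIV"
    by (simp add: p_def)
  have sign: "lattice_term (- q) a x = (if x \<in> P then lattice_term q a x else - lattice_term q a x)" for x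
  proof (cases x)
    case (Pair n r)
    have "(- q) ^ (n * (n + 2 * a)) = (if even n then q ^ (n * (n + 2 * a)) else - (q ^ (n * (n + 2 * a))))"
      by simp
    then show ?thesis
      by (simp add: Pair lattice_term_def P_def powi_minus_base even_tri_linear[OF a])
  qed
  have R: "R = 1 / (qpoch_inf (p ^ (2 + 2 * a)) (p ^ 10) * qpoch_inf (p ^ (8 - 2 * a)) (p ^ 10))"
  proof -
    have "4 * (1 + a) = 2 * (2 + 2 * a)" "4 * (4 - a) = 2 * (8 - 2 * a)" "4 * 5 = 2 * (10::nat)"
      by simp_all
    then show ?thesis
      unfolding R_def p_def power_mult[symmetric] by (simp only:)
  qed
  have pp: "p ^ 8 = q ^ 16" "p ^ 3 = q ^ 6" "p ^ 5 = q ^ 10" "p ^ 7 = q ^ 14" "p ^ 1 = q ^ 2"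
    unfolding p_def power_mult[symmetric] by simp_all
  have half: "(c * A + c * B) / 2 = c * ((A + B) / 2)" "(c * A - c * B) / 2 = c * ((A - B) / 2)" for c A B :: complex
    by (simp_all add: ring_distribs)
  note split = has_sum_split_sign[OF L L' sign]
  consider "e = 0" | "e = 1"
    using e by linarith
  then show ?thesis
  proof cases
    case 1
    have "{(n, r). even (int n - r) \<longleftrightarrow> even e} = P"
      using 1 by (auto simp: P_def)
    moreover have "(R / qpoch_inf p p * infsum (\<lambda>r. q powi tri (2 * r)) UNIV + R / qpoch_inf p p * infsum (\<lambda>r. (- q) powi tri (2 * r)) UNIV) / 2
       = R / qpoch_inf p p * (qpoch_inf (- (p ^ 3)) (p ^ 8) * qpoch_inf (- (p ^ 5)) (p ^ 8) * qpoch_inf (p ^ 8) (p ^ 8))"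
      unfolding pp theta_split(1)[OF q, symmetric] by (rule half)
    ultimately show ?thesis
      using split(1) 1 by (simp add: R mult_ac)
  next
    case 2
    have "{(n, r). even (int n - r) \<longleftrightarrow> even e} = - P"
      using 2 by (auto simp: P_def)
    moreover have "(R / qpoch_inf p p * infsum (\<lambda>r. q powi tri (2 * r)) UNIV - R / qpoch_inf p p * infsum (\<lambda>r. (- q) powi tri (2 * r)) UNIV) / 2
       = R / qpoch_inf p p * (q * (qpoch_inf (- (p ^ 7)) (p ^ 8) * qpoch_inf (- (p ^ 1)) (p ^ 8) * qpoch_inf (p ^ 8) (p ^ 8)))"
      unfolding pp theta_split(2)[OF q, symmetric] by (rule half)
    ultimately show ?thesis
      using split(2) 2 by (simp add: R mult_ac)
  qed
qed

text \<open>The substitution \<open>n = i + j + u\<close>, \<open>r = i - j + u - e\<close> turns the two indices of the lattice term into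
  \<open>n - r = 2 j + e\<close> and \<open>n + r + a = 2 i + d\<close>.\<close>

lemma has_sum_double_index:
  fixes X :: "nat \<Rightarrow> nat \<Rightarrow> int"
  assumes q: "norm q < 1" "q \<noteq> 0"
    and a: "a \<le> 1" and e: "e \<le> 1" and d: "d \<le> 1" "d + e = a + 2 * u"
    and even: "\<And>i j. even (X i j)"
    and X: "\<And>i j. 2 * (X i j + int e) = 2 * ((int i + int j + int u) * (int i + int j + int u + 2 * int a))
      + (2 * (int i - int j + int u - int e) + int a) * (2 * (int i - int j + int u - int e) + int a - 1)"
  defines "p \<equiv> q\<^sup>2"
  shows "((\<lambda>(i, j). p powi (X i j div 2) / (qpoch p p (2 * i + d) * qpoch p p (2 * j + e))) has_sum
     (qpoch_inf (- (p ^ (3 + 4 * e))) (p ^ 8) * qpoch_inf (- (p ^ (5 - 4 * e))) (p ^ 8) * qpoch_inf (p ^ 8) (p ^ 8)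
      / (qpoch_inf p p * (qpoch_inf (p ^ (2 + 2 * a)) (p ^ 10) * qpoch_inf (p ^ (8 - 2 * a)) (p ^ 10))))) UNIV"
    (is "(?f has_sum ?S) UNIV")
proof -
  define h where "h = (\<lambda>(i, j). (i + j + u, int i - int j + int u - int e))"
  have h1: "int (i + j + u) - (int i - int j + int u - int e) = int (2 * j + e)"
    and h2: "int (i + j + u) + (int i - int j + int u - int e) + int a = int (2 * i + d)" for i j
    using d by simp_all
  have summand: "lattice_term q a (h (i, j)) = q ^ e * ?f (i, j)" for i j
  proof -
    \<comment> \<open>This \<open>r\<close> is the argument of \<open>tri\<close>, that is twice the
      second lattice coordinate plus \<open>a\<close>. The hypothesis on \<open>X\<close> says that
      \<open>X i j + e\<close> is the power of \<open>q\<close> in the lattice term.\<close>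
    define n r where "n = int (i + j + u)" and "r = 2 * (int i - int j + int u - int e) + int a"
    have "2 * (X i j + int e) = 2 * (n * (n + 2 * int a) + tri r)"
      unfolding distrib_left[of 2 "n * _"] tri_double X[of i j] by (simp add: n_def r_def)
    then have "int e + X i j = n * (n + 2 * int a) + tri r"
      by (subst (asm) mult_cancel_left) simp
    then have "q powi int e * q powi X i j = q powi (n * (n + 2 * int a)) * q powi tri r"
      using q(2) by (simp only: power_int_add[symmetric] simp_thms)
    also have "n * (n + 2 * int a) = int ((i + j + u) * (i + j + u + 2 * a))"
      by (simp add: n_def)
    finally have "q ^ ((i + j + u) * (i + j + u + 2 * a)) * q powi tri r = q ^ e * q powi X i j"
      by (simp only: power_int_of_nat)
    moreover have "q powi X i j = p powi (X i j div 2)"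
      using even[of i j] unfolding p_def power_int_power by simp
    ultimately show ?thesis
      unfolding h_def lattice_term_def prod.case h1 h2 rpoch_of_nat r_def[symmetric] p_def[symmetric]
      by (simp add: mult.assoc[symmetric])
  qed
  have half_parity: "x = 2 * int (nat (x div 2)) + int c" if "x \<ge> 0" "c \<le> 1" "even x \<longleftrightarrow> even c" for x :: int and c :: nat
  proof -
    have "c = 0 \<or> c = 1"
      using that(2) by linarith
    then show ?thesis
      using that(1,3) by (auto simp: odd_two_times_div_two_succ)
  qed
  have "inj h"
    by (auto simp: inj_def h_def)
  have "(lattice_term q a has_sum (q ^ e * ?S)) {(n, r). even (int n - r) \<longleftrightarrow> even e}"
    unfolding p_def by (rule has_sum_lattice_term_parity[OF q a e])
  \<comment> \<open>The parity class and the image of \<open>h\<close> differ only where the lattice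
    term is zero: a nonzero term has both \<open>rpoch\<close> indices nonnegative, and these then
    have the form \<open>2 * j + e\<close> and \<open>2 * i + d\<close>.\<close>
  also have "?this \<longleftrightarrow> (lattice_term q a has_sum (q ^ e * ?S)) (range h)"
  proof (rule has_sum_cong_neutral)
    fix x assume "x \<in> range h - {(n, r). even (int n - r) \<longleftrightarrow> even e}"
    moreover have "even (int (2 * j + e)) \<longleftrightarrow> even e" for j
      by simp
    ultimately show "lattice_term q a x = 0"
      unfolding h_def by (auto simp only: h1 prod.case split: prod.splits)
  next
    fix x assume x: "x \<in> {(n, r). even (int n - r) \<longleftrightarrow> even e} - range h"
    obtain n r where nr: "x = (n, r)"
      by (cases x)
    show "lattice_term q a x = 0"
    proof (rule ccontr)
      assume "lattice_term q a x \<noteq> 0"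
      then have "rpoch (q\<^sup>2) (int n - r) \<noteq> 0" "rpoch (q\<^sup>2) (int n + r + int a) \<noteq> 0"
        by (auto simp: nr lattice_term_def)
      then have nonneg: "int n - r \<ge> 0" "int n + r + int a \<ge> 0"
        by (auto simp: rpoch_def split: if_splits)
      have par: "even (int n - r) \<longleftrightarrow> even e"
        using x by (simp add: nr)
      define j i where "j = nat ((int n - r) div 2)" and "i = nat ((int n + r + int a) div 2)"
      have j: "int n - r = 2 * int j + int e"
        unfolding j_def by (rule half_parity[OF nonneg(1) e par])
      \<comment> \<open>The relation \<open>d + e = a + 2 * u\<close> transfers the parity condition
        from \<open>n - r\<close> to \<open>n + r + a\<close>.\<close>
      have "int n + r + int a - int d = 2 * (int n - int j - int u)"
        using j d(2) by simp
      then have par': "even (int n + r + int a) \<longleftrightarrow> even d"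
        by presburger
      have i: "int n + r + int a = 2 * int i + int d"
        unfolding i_def by (rule half_parity[OF nonneg(2) d(1) par'])
      have "x = h (i, j)"
        using i j d(2) by (auto simp: nr h_def)
      then show False
        using x by auto
    qed
  qed simp
  also have "\<dots> \<longleftrightarrow> ((\<lambda>x. q ^ e * ?f x) has_sum (q ^ e * ?S)) UNIV"
    unfolding has_sum_reindex[OF \<open>inj h\<close>] o_def by (rule has_sum_cong) (auto simp only: summand split_paired_all)
  finally show ?thesis
    using q(2) by (simp add: has_sum_cmult_right_iff)
qed

text \<open>Base zero is treated apart because the argument above inverts \<open>q\<close>. Away
  from the origin the halved exponent is positive, so only the term 1 at (0, 0) remains.\<close>

lemma has_sum_zero_base:
  fixes X :: "nat \<Rightarrow> nat \<Rightarrow> int"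
  assumes "S = 1" "X 0 0 = 0" "\<And>i j. (i, j) \<noteq> (0, 0) \<Longrightarrow> X i j \<ge> 2"
  shows "((\<lambda>(i, j). (0::complex) powi (X i j div 2) / (qpoch 0 0 (m i) * qpoch 0 0 (n j))) has_sum S) UNIV"
proof (rule has_sum_finite_neutralI[of "{(0, 0)}"])
  fix x :: "nat \<times> nat" assume x: "x \<in> UNIV - {(0, 0)}"
  obtain i j where ij: "x = (i, j)"
    by (cases x)
  then have "X i j div 2 \<noteq> 0"
    using x assms(3)[of i j] by auto
  then show "(case x of (i, j) \<Rightarrow> (0::complex) powi (X i j div 2) / (qpoch 0 0 (m i) * qpoch 0 0 (n j))) = 0"
    by (simp add: ij)
qed (simp_all add: assms(1,2) qpoch_def)

lemma qpoch_inf_0 [simp]: "qpoch_inf 0 q = 1"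
  by (simp add: qpoch_inf_def)

section \<open>The four identities from the choices of index parities\<close>

theorem theorem1p3:
  fixes q :: complex
  assumes "norm q < 1"
  shows "((\<lambda>(i, j). q powi ((3 * int i^2 - 2 * int i * int j + 3 * int j^2 - int i + int j) div 2)
            / (qpoch q q (2 * i) * qpoch q q (2 * j)))
          has_sum (qpochs_inf [- (q^3), - (q^5), q^8] (q^8) / (qpoch_inf q q * qpochs_inf [q^2, q^8] (q^10))))
          (UNIV :: (nat \<times> nat) set)
       \<and> ((\<lambda>(i, j). q powi ((3 * int i^2 - 2 * int i * int j + 3 * int j^2 + int i + 3 * int j) div 2)
            / (qpoch q q (2 * i + 1) * qpoch q q (2 * j + 1)))
          has_sum (qpochs_inf [- q, - (q^7), q^8] (q^8) / (qpoch_inf q q * qpochs_inf [q^2, q^8] (q^10))))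
          (UNIV :: (nat \<times> nat) set)
       \<and> ((\<lambda>(i, j). q powi ((3 * int i^2 - 2 * int i * int j + 3 * int j^2 + 3 * int i + int j) div 2)
            / (qpoch q q (2 * i + 1) * qpoch q q (2 * j)))
          has_sum (qpochs_inf [- (q^3), - (q^5), q^8] (q^8) / (qpoch_inf q q * qpochs_inf [q^4, q^6] (q^10))))
          (UNIV :: (nat \<times> nat) set)
       \<and> ((\<lambda>(i, j). q powi ((3 * int i^2 - 2 * int i * int j + 3 * int j^2 - int i + 5 * int j) div 2)
            / (qpoch q q (2 * i) * qpoch q q (2 * j + 1)))
          has_sum (qpochs_inf [- q, - (q^7), q^8] (q^8) / (qpoch_inf q q * qpochs_inf [q^4, q^6] (q^10))))
          (UNIV :: (nat \<times> nat) set)"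
proof (cases "q = 0")
  case True
  \<comment> \<open>Since the doubled exponents are even, the lower bound 1 already gives 2, and
    halving leaves a positive power of zero.\<close>
  have ev: "x \<ge> 2" if "even x" "x \<ge> 1" for x :: int
    using that by presburger
  have ge: "3 * int i^2 - 2 * int i * int j + 3 * int j^2 - int i + int j \<ge> 2"
    "3 * int i^2 - 2 * int i * int j + 3 * int j^2 + int i + 3 * int j \<ge> 2"
    "3 * int i^2 - 2 * int i * int j + 3 * int j^2 + 3 * int i + int j \<ge> 2"
    "3 * int i^2 - 2 * int i * int j + 3 * int j^2 - int i + 5 * int j \<ge> 2"
    if "(i, j) \<noteq> (0, 0)" for i j
  proof -
    have "(int i - int j)^2 = int i^2 - 2 * int i * int j + int j^2"
      by (simp add: power2_eq_square algebra_simps)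
    moreover have "int i \<le> int i^2" "int j \<le> int j^2"
      by (cases i; cases j; auto simp: power2_eq_square algebra_simps)+
    moreover have "int i + int j \<ge> 1"
      using that by auto
    moreover have "(int i - int j)^2 \<ge> 0"
      by simp
    ultimately show "3 * int i^2 - 2 * int i * int j + 3 * int j^2 - int i + int j \<ge> 2"
      "3 * int i^2 - 2 * int i * int j + 3 * int j^2 + int i + 3 * int j \<ge> 2"
      "3 * int i^2 - 2 * int i * int j + 3 * int j^2 + 3 * int i + int j \<ge> 2"
      "3 * int i^2 - 2 * int i * int j + 3 * int j^2 - int i + 5 * int j \<ge> 2"
      by (intro ev qexponents_even; linarith)+
  qed
  show ?thesis
    unfolding True by (intro conjI has_sum_zero_base ge) (simp_all add: qpochs_inf_def)
next
  case False
  \<comment> \<open>The lattice sum lives in a square root of the base; the choice of root is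
    immaterial, as only its square appears in the result.\<close>
  define s where "s = csqrt q"
  have sq: "s\<^sup>2 = q"
    by (simp add: s_def)
  then have s0: "s \<noteq> 0"
    using False by auto
  have s1: "norm s < 1"
    using assms sq by (metis abs_norm_cancel abs_square_less_1 norm_power)
  note main = has_sum_double_index[OF s1 s0, unfolded sq]
  \<comment> \<open>The denominators prescribe \<open>d\<close> and \<open>e\<close>, the parities
    of the two indices; \<open>a\<close> is the parity of \<open>d + e\<close>, and
    \<open>u = 1\<close> only when both are odd.\<close>
  have 1: "((\<lambda>(i, j). q powi ((3 * int i^2 - 2 * int i * int j + 3 * int j^2 - int i + int j) div 2) / (qpoch q q (2 * i + 0) * qpoch q q (2 * j + 0))) has_sum
     (qpoch_inf (- (q ^ (3 + 4 * 0))) (q ^ 8) * qpoch_inf (- (q ^ (5 - 4 * 0))) (q ^ 8) * qpoch_inf (q ^ 8) (q ^ 8)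
      / (qpoch_inf q q * (qpoch_inf (q ^ (2 + 2 * 0)) (q ^ 10) * qpoch_inf (q ^ (8 - 2 * 0)) (q ^ 10))))) (UNIV :: (nat \<times> nat) set)"
    by (rule main[where u = 0]) (rule qexponents_even | simp add: power2_eq_square algebra_simps)+
  have 2: "((\<lambda>(i, j). q powi ((3 * int i^2 - 2 * int i * int j + 3 * int j^2 + int i + 3 * int j) div 2) / (qpoch q q (2 * i + 1) * qpoch q q (2 * j + 1))) has_sum
     (qpoch_inf (- (q ^ (3 + 4 * 1))) (q ^ 8) * qpoch_inf (- (q ^ (5 - 4 * 1))) (q ^ 8) * qpoch_inf (q ^ 8) (q ^ 8)
      / (qpoch_inf q q * (qpoch_inf (q ^ (2 + 2 * 0)) (q ^ 10) * qpoch_inf (q ^ (8 - 2 * 0)) (q ^ 10))))) (UNIV :: (nat \<times> nat) set)"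
    by (rule main[where u = 1]) (rule qexponents_even | simp add: power2_eq_square algebra_simps)+
  have 3: "((\<lambda>(i, j). q powi ((3 * int i^2 - 2 * int i * int j + 3 * int j^2 + 3 * int i + int j) div 2) / (qpoch q q (2 * i + 1) * qpoch q q (2 * j + 0))) has_sum
     (qpoch_inf (- (q ^ (3 + 4 * 0))) (q ^ 8) * qpoch_inf (- (q ^ (5 - 4 * 0))) (q ^ 8) * qpoch_inf (q ^ 8) (q ^ 8)
      / (qpoch_inf q q * (qpoch_inf (q ^ (2 + 2 * 1)) (q ^ 10) * qpoch_inf (q ^ (8 - 2 * 1)) (q ^ 10))))) (UNIV :: (nat \<times> nat) set)"
    by (rule main[where u = 0]) (rule qexponents_even | simp add: power2_eq_square algebra_simps)+
  have 4: "((\<lambda>(i, j). q powi ((3 * int i^2 - 2 * int i * int j + 3 * int j^2 - int i + 5 * int j) div 2) / (qpoch q q (2 * i + 0) * qpoch q q (2 * j + 1))) has_sum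
     (qpoch_inf (- (q ^ (3 + 4 * 1))) (q ^ 8) * qpoch_inf (- (q ^ (5 - 4 * 1))) (q ^ 8) * qpoch_inf (q ^ 8) (q ^ 8)
      / (qpoch_inf q q * (qpoch_inf (q ^ (2 + 2 * 1)) (q ^ 10) * qpoch_inf (q ^ (8 - 2 * 1)) (q ^ 10))))) (UNIV :: (nat \<times> nat) set)"
    by (rule main[where u = 0]) (rule qexponents_even | simp add: power2_eq_square algebra_simps)+
  show ?thesis
    using 1 2 3 4 by (simp add: qpochs_inf_def mult_ac)
qed

end
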